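(* Let $Q$ be an acyclic finite quiver, $k$ a field, $M$ a representation of $Q$ over $k$ of dimension vector $\underline{m}$, and $\underline{e}$ another dimension vector. Then the quiver Grassmannian $\operatorname{Gr}_{\underline{e}}(M)$ is isomorphic to the geometric quotient $\operatorname{Hom}^0(\underline{e},M)/G_{\underline{e}}$.
   Context: Acyclic means without oriented cycles. $M=((M_i)_{i\in Q_0},(M_\alpha)_{\alpha\in Q_1})$, where $M_\alpha:M_i\to M_j$ for an arrow $\alpha:i\to j$. $\operatorname{Gr}_{\underline{e}}(M)$ is the variety of subrepresentations of $M$ of dimension vector $\underline{e}$. Fix $k$-vector spaces $U_i$ with $\dim U_i=e_i$, $i\in Q_0$. Let $E_{\underline{e}}=\prod_{\alpha:i\to j}\operatorname{Hom}_k(U_i,U_j)$, $G_{\underline{e}}=\prod_{i\in Q_0}\operatorname{GL}(U_i)$ and $\operatorname{Hom}(\underline{e},\underline{m})=\prod_{i\in Q_0}\operatorname{Hom}_k(U_i,M_i)$. $\operatorname{Hom}^0(\underline{e},M)$ is the subvariety of $E_{\underline{e}}\times\operatorname{Hom}(\underline{e},\underline{m})$ of pairs $((U_\alpha)_\alpha,(f_i)_i)$ such that all $f_i$ are injective and $M_\alpha f_i=f_jU_\alpha$ for all arrows $\alpha:i\to j$. The group $G_{\underline{e}}$ acts freely on it by $(g_i)_i\cdot((U_\alpha),(f_i))=((g_jU_\alpha g_i^{-1})_{\alpha:i\to j},(f_ig_i^{-1})_i)$. *)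

theory Defs
  imports
    "HOL-Algebra.Algebraic_Closure_Type"
    "HOL-Algebra.Group_Action"
    "HOL-Analysis.Abstract_Topology"
    "Graph_Theory.Digraph"
    "Jordan_Normal_Form.VS_Connect"
begin

section \<open>Varieties over a field\<close>

text \<open>
  A variety over \<open>k\<close> is given by its points over an algebraic closure \<open>K\<close> of \<open>k\<close>, the
  \<open>k\<close>-Zariski topology on them, and the sheaf of regular functions defined over \<open>k\<close>, viewed as
  \<open>K\<close>-valued functions. For reduced schemes of finite type over \<open>k\<close> these data are equivalent to
  the scheme. Topology and functions are not those of the base change to \<open>K\<close>: all
  coefficients lie in \<open>k\<close>.
\<close>

record (overloaded) ('x, 'k :: field) kspace =
  zariski :: "'x topology"
  regular :: "'x set \<Rightarrow> ('x \<Rightarrow> 'k alg_closure) set"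

text \<open>
  Members of \<open>regular E U\<close> are total functions, of which only the values on \<open>U\<close> matter.
\<close>

abbreviation points :: "('x, 'k :: field) kspace \<Rightarrow> 'x set"
  where "points E \<equiv> topspace (zariski E)"

text \<open>The image of \<open>k[t\<^sub>c | c \<in> C]\<close> in the ring of functions, for coordinate functions \<open>C\<close>.\<close>

inductive_set kpoly :: "('x \<Rightarrow> 'k :: field alg_closure) set \<Rightarrow> ('x \<Rightarrow> 'k alg_closure) set"
  for C :: "('x \<Rightarrow> 'k :: field alg_closure) set"
where
  const: "(\<lambda>_. to_ac c) \<in> kpoly C"
| coord: "t \<in> C \<Longrightarrow> t \<in> kpoly C"
| add: "p \<in> kpoly C \<Longrightarrow> q \<in> kpoly C \<Longrightarrow> (\<lambda>x. p x + q x) \<in> kpoly C"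
| mult: "p \<in> kpoly C \<Longrightarrow> q \<in> kpoly C \<Longrightarrow> (\<lambda>x. p x * q x) \<in> kpoly C"

text \<open>
  The structure induced on a set \<open>D\<close> that is embedded into affine space by the coordinates \<open>C\<close>:
  the Zariski topology, and functions that are locally quotients of polynomials.
\<close>

definition embedded_space :: "'x set \<Rightarrow> ('x \<Rightarrow> 'k :: field alg_closure) set \<Rightarrow> ('x, 'k) kspace"
  where "embedded_space D C =
    (let Z = topology_generated_by {{x \<in> D. p x \<noteq> 0} | p. p \<in> kpoly C} in
     \<lparr>zariski = Z,
      regular = (\<lambda>U. {h. \<forall>x\<in>U. \<exists>W. openin Z W \<and> x \<in> W \<and> W \<subseteq> U \<and>
        (\<exists>p\<in>kpoly C. \<exists>q\<in>kpoly C. \<forall>y\<in>W. q y \<noteq> 0 \<and> h y = p y / q y)})\<rparr>)"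

definition glued_space ::
    "('x set \<times> ('x \<Rightarrow> 'k :: field alg_closure) set) set \<Rightarrow> ('x, 'k) kspace"
  where "glued_space \<A> =
    \<lparr>zariski = topology (\<lambda>W. W \<subseteq> (\<Union>(D, C)\<in>\<A>. D) \<and>
       (\<forall>(D, C)\<in>\<A>. openin (zariski (embedded_space D C)) (W \<inter> D))),
     regular = (\<lambda>W. {h. \<forall>(D, C)\<in>\<A>. h \<in> regular (embedded_space D C) (W \<inter> D)})\<rparr>"

lemma openin_glued_space:
  "openin (zariski (glued_space \<A>)) W \<longleftrightarrow>
    W \<subseteq> (\<Union>(D, C)\<in>\<A>. D) \<and> (\<forall>(D, C)\<in>\<A>. openin (zariski (embedded_space D C)) (W \<inter> D))"
proof -
  have "istopology (\<lambda>W. W \<subseteq> (\<Union>(D, C)\<in>\<A>. D) \<and>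
      (\<forall>(D, C)\<in>\<A>. openin (zariski (embedded_space D C)) (W \<inter> D)))"
    unfolding istopology_def
  proof (intro conjI allI impI)
    fix S T
    assume S: "S \<subseteq> (\<Union>(D, C)\<in>\<A>. D) \<and>
        (\<forall>(D, C)\<in>\<A>. openin (zariski (embedded_space D C)) (S \<inter> D))"
      and T: "T \<subseteq> (\<Union>(D, C)\<in>\<A>. D) \<and>
        (\<forall>(D, C)\<in>\<A>. openin (zariski (embedded_space D C)) (T \<inter> D))"
    show "S \<inter> T \<subseteq> (\<Union>(D, C)\<in>\<A>. D)" using S by blast
    have "openin (zariski (embedded_space D C)) (S \<inter> T \<inter> D)" if "(D, C) \<in> \<A>" for D C
    proof -
      have "openin (zariski (embedded_space D C)) ((S \<inter> D) \<inter> (T \<inter> D))"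
        using S T that by (intro openin_Int[of _ "S \<inter> D" "T \<inter> D"]) blast+
      moreover have "(S \<inter> D) \<inter> (T \<inter> D) = S \<inter> T \<inter> D" by blast
      ultimately show ?thesis by metis
    qed
    then show "\<forall>(D, C)\<in>\<A>. openin (zariski (embedded_space D C)) (S \<inter> T \<inter> D)"
      by blast
  next
    fix \<K>
    assume K: "\<forall>W\<in>\<K>. W \<subseteq> (\<Union>(D, C)\<in>\<A>. D) \<and>
        (\<forall>(D, C)\<in>\<A>. openin (zariski (embedded_space D C)) (W \<inter> D))"
    then show "\<Union>\<K> \<subseteq> (\<Union>(D, C)\<in>\<A>. D)" by blast
    have "openin (zariski (embedded_space D C)) (\<Union>\<K> \<inter> D)" if "(D, C) \<in> \<A>" for D C
    proof -
      have "openin (zariski (embedded_space D C)) (\<Union>W\<in>\<K>. W \<inter> D)"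
        using K that by (intro openin_clauses(3)) auto
      moreover have "(\<Union>W\<in>\<K>. W \<inter> D) = \<Union>\<K> \<inter> D" by blast
      ultimately show ?thesis by metis
    qed
    then show "\<forall>(D, C)\<in>\<A>. openin (zariski (embedded_space D C)) (\<Union>\<K> \<inter> D)"
      by blast
  qed
  then show ?thesis by (simp add: glued_space_def topology_inverse')
qed

definition morphism ::
    "('x, 'k :: field) kspace \<Rightarrow> ('y, 'k) kspace \<Rightarrow> ('x \<Rightarrow> 'y) \<Rightarrow> bool"
  where "morphism E Y \<phi> \<longleftrightarrow>
    continuous_map (zariski E) (zariski Y) \<phi> \<and>
    (\<forall>V. openin (zariski Y) V \<longrightarrow>
      (\<forall>h\<in>regular Y V. h \<circ> \<phi> \<in> regular E {x \<in> points E. \<phi> x \<in> V}))"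

definition isomorphic :: "('x, 'k :: field) kspace \<Rightarrow> ('y, 'k) kspace \<Rightarrow> bool"
  where "isomorphic E Y \<longleftrightarrow> (\<exists>\<phi> \<psi>. morphism E Y \<phi> \<and> morphism Y E \<psi> \<and>
    (\<forall>x\<in>points E. \<psi> (\<phi> x) = x) \<and> (\<forall>y\<in>points Y. \<phi> (\<psi> y) = y))"

definition open_subspace :: "('x, 'k :: field) kspace \<Rightarrow> 'x set \<Rightarrow> ('x, 'k) kspace"
  where "open_subspace E U = \<lparr>zariski = subtopology (zariski E) U, regular = regular E\<rparr>"

definition affine_coords :: "nat \<Rightarrow> ('k :: field alg_closure vec \<Rightarrow> 'k alg_closure) set"
  where "affine_coords n = {(\<lambda>v. v $ i) | i. i < n}"

definition affine_variety ::
    "nat \<Rightarrow> ('k :: field alg_closure vec \<Rightarrow> 'k alg_closure) set \<Rightarrow> ('k alg_closure vec, 'k) kspace"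
  where "affine_variety n F =
    embedded_space {v \<in> carrier_vec n. \<forall>p\<in>F. p v = 0} (affine_coords n)"

definition prevariety :: "('x, 'k :: field) kspace \<Rightarrow> bool"
  where "prevariety E \<longleftrightarrow> (\<exists>\<U>. finite \<U> \<and> \<Union>\<U> = points E \<and>
    (\<forall>U\<in>\<U>. openin (zariski E) U \<and>
      (\<exists>n F. F \<subseteq> kpoly (affine_coords n) \<and>
        isomorphic (open_subspace E U) (affine_variety n F))))"


section \<open>Geometric quotients\<close>

text \<open>
  The four conditions of Mumford's definition (Geometric Invariant Theory, Definition 0.6), in
  which separatedness of the quotient is not required. Half of the third and fourth condition is
  part of \<open>morphism\<close>. \<open>G\<close> is the group of \<open>K\<close>-points, so that fibres and invariance are
  tested on geometric points.
\<close>

definition geometric_quotient ::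
    "('g, 'b) monoid_scheme \<Rightarrow> ('g \<Rightarrow> 'x \<Rightarrow> 'x) \<Rightarrow> ('x, 'k :: field) kspace \<Rightarrow>
     ('y, 'k) kspace \<Rightarrow> ('x \<Rightarrow> 'y) \<Rightarrow> bool"
  where "geometric_quotient G act E Y \<pi> \<longleftrightarrow>
    prevariety Y \<and> morphism E Y \<pi> \<and>
    (\<forall>g\<in>carrier G. \<forall>x\<in>points E. \<pi> (act g x) = \<pi> x) \<and>
    (\<pi> ` points E = points Y \<and>
      (\<forall>x\<in>points E. \<forall>x'\<in>points E. \<pi> x = \<pi> x' \<longrightarrow> x' \<in> Group_Action.orbit G act x)) \<and>
    (\<forall>V\<subseteq>points Y. openin (zariski E) {x \<in> points E. \<pi> x \<in> V} \<longrightarrow> openin (zariski Y) V) \<and>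
    (\<forall>V h. openin (zariski Y) V \<longrightarrow> h \<in> regular E {x \<in> points E. \<pi> x \<in> V} \<longrightarrow>
      (\<forall>g\<in>carrier G. \<forall>x\<in>points E. \<pi> x \<in> V \<longrightarrow> h (act g x) = h x) \<longrightarrow>
      (\<exists>h'\<in>regular Y V. \<forall>x\<in>points E. \<pi> x \<in> V \<longrightarrow> h x = h' (\<pi> x)))"

text \<open>
  The space \<open>E/G\<close>: orbits, quotient topology, invariant regular functions. If a geometric quotient
  exists, it is this one, but \<open>E/G\<close> need not be a prevariety in general.
\<close>

definition orbit_space ::
    "('g, 'b) monoid_scheme \<Rightarrow> ('g \<Rightarrow> 'x \<Rightarrow> 'x) \<Rightarrow> ('x, 'k :: field) kspace \<Rightarrow> ('x set, 'k) kspace"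
  where "orbit_space G act E =
    \<lparr>zariski = topology (\<lambda>W. W \<subseteq> Group_Action.orbits G (points E) act \<and>
       openin (zariski E) {x \<in> points E. Group_Action.orbit G act x \<in> W}),
     regular = (\<lambda>W. {h. (\<lambda>x. h (Group_Action.orbit G act x))
       \<in> regular E {x \<in> points E. Group_Action.orbit G act x \<in> W}})\<rparr>"

lemma openin_orbit_space:
  "openin (zariski (orbit_space G act E)) W \<longleftrightarrow>
    W \<subseteq> Group_Action.orbits G (points E) act \<and>
    openin (zariski E) {x \<in> points E. Group_Action.orbit G act x \<in> W}"
proof -
  let ?o = "Group_Action.orbit G act"
  let ?P = "\<lambda>W. {x \<in> points E. ?o x \<in> W}"
  have Int: "?P (S \<inter> T) = ?P S \<inter> ?P T" for S T by blast
  have Union: "?P (\<Union>\<K>) = (\<Union>W\<in>\<K>. ?P W)" for \<K> by blast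
  have "istopology (\<lambda>W. W \<subseteq> Group_Action.orbits G (points E) act \<and> openin (zariski E) (?P W))"
    unfolding istopology_def Int Union by (auto intro!: openin_Int openin_clauses(3))
  then show ?thesis by (simp add: orbit_space_def topology_inverse')
qed


section \<open>Quiver representations\<close>

text \<open>
  The spaces \<open>V i\<close> of a representation are subspaces of one ambient \<open>k\<close>-vector space, which
  may be large (e.g. their direct sum); the values of \<open>T \<alpha>\<close> outside \<open>V (tail Q \<alpha>)\<close> are irrelevant.
\<close>

definition quiver_representation ::
    "('i, 'a) pre_digraph \<Rightarrow> ('k :: field \<Rightarrow> 'v :: ab_group_add \<Rightarrow> 'v) \<Rightarrow>
     ('i \<Rightarrow> 'v set) \<Rightarrow> ('a \<Rightarrow> 'v \<Rightarrow> 'v) \<Rightarrow> bool"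
  where "quiver_representation Q scale V T \<longleftrightarrow>
    vector_space scale \<and>
    (\<forall>i\<in>verts Q. Modules.module.subspace scale (V i)) \<and>
    (\<forall>\<alpha>\<in>arcs Q. T \<alpha> \<in> V (tail Q \<alpha>) \<rightarrow> V (head Q \<alpha>) \<and>
      (\<forall>x\<in>V (tail Q \<alpha>). \<forall>y\<in>V (tail Q \<alpha>). T \<alpha> (x + y) = T \<alpha> x + T \<alpha> y) \<and>
      (\<forall>c. \<forall>x\<in>V (tail Q \<alpha>). T \<alpha> (scale c x) = scale c (T \<alpha> x)))"

definition has_dimension_vector ::
    "('i, 'a) pre_digraph \<Rightarrow> ('k :: field \<Rightarrow> 'v :: ab_group_add \<Rightarrow> 'v) \<Rightarrow>
     ('i \<Rightarrow> 'v set) \<Rightarrow> ('i \<Rightarrow> nat) \<Rightarrow> bool"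
  where "has_dimension_vector Q scale V m \<longleftrightarrow>
    (\<forall>i\<in>verts Q. (\<exists>B. finite B \<and> V i = Modules.module.span scale B) \<and> vector_space.dim scale (V i) = m i)"

definition ordered_basis ::
    "('k :: field \<Rightarrow> 'v :: ab_group_add \<Rightarrow> 'v) \<Rightarrow> 'v set \<Rightarrow> nat \<Rightarrow> (nat \<Rightarrow> 'v) \<Rightarrow> bool"
  where "ordered_basis scale W d b \<longleftrightarrow>
    inj_on b {..<d} \<and> \<not> Modules.module.dependent scale (b ` {..<d}) \<and> Modules.module.span scale (b ` {..<d}) = W"

text \<open>
  The matrix of \<open>T \<alpha>\<close> in the bases \<open>b\<close>. It identifies \<open>K \<otimes> V i\<close> with \<open>K\<^bsup>m i\<^esup>\<close> and
  \<open>K \<otimes> T \<alpha>\<close> with multiplication by the matrix.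
\<close>

definition representation_matrix ::
    "('i, 'a) pre_digraph \<Rightarrow> ('k :: field \<Rightarrow> 'v :: ab_group_add \<Rightarrow> 'v) \<Rightarrow>
     ('i \<Rightarrow> nat) \<Rightarrow> ('i \<Rightarrow> nat \<Rightarrow> 'v) \<Rightarrow> ('a \<Rightarrow> 'v \<Rightarrow> 'v) \<Rightarrow> 'a \<Rightarrow> 'k mat"
  where "representation_matrix Q scale m b T \<alpha> =
    (let i = tail Q \<alpha>; j = head Q \<alpha> in
     mat (m j) (m i) (\<lambda>(r, c).
       Modules.module.representation scale (b j ` {..<m j}) (T \<alpha> (b i c)) (b j r)))"


section \<open>The quiver Grassmannian\<close>

definition subspaces :: "nat \<Rightarrow> nat \<Rightarrow> 'f :: field vec set set"
  where "subspaces n d = {W. VectorSpace.subspace class_ring W (module_vec TYPE('f) n) \<and>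
    vectorspace.dim class_ring (module_vec TYPE('f) n\<lparr>carrier := W\<rparr>) = d}"

definition subrepresentations ::
    "('i, 'a) pre_digraph \<Rightarrow> ('a \<Rightarrow> 'k :: field mat) \<Rightarrow> ('i \<Rightarrow> nat) \<Rightarrow> ('i \<Rightarrow> nat) \<Rightarrow>
     ('i \<Rightarrow> 'k alg_closure vec set) set"
  where "subrepresentations Q A m e = {N \<in> (\<Pi>\<^sub>E i\<in>verts Q. subspaces (m i) (e i)).
    \<forall>\<alpha>\<in>arcs Q. \<forall>v\<in>N (tail Q \<alpha>). map_mat to_ac (A \<alpha>) *\<^sub>v v \<in> N (head Q \<alpha>)}"

text \<open>
  Standard affine charts of a product of Grassmannians. The chart of \<open>S\<close> consists of the \<open>N\<close> for
  which the coordinate projections \<open>N i \<rightarrow> K\<^bsup>S i\<^esup>\<close> are bijective; \<open>N i\<close> then has a unique basis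
  whose rows in \<open>S i\<close> form the identity matrix, and the chart coordinates are the other entries
  of that basis.
\<close>

definition chart_indices ::
    "('i, 'a) pre_digraph \<Rightarrow> ('i \<Rightarrow> nat) \<Rightarrow> ('i \<Rightarrow> nat) \<Rightarrow> ('i \<Rightarrow> nat set) set"
  where "chart_indices Q m e = (\<Pi>\<^sub>E i\<in>verts Q. {S. S \<subseteq> {..<m i} \<and> card S = e i})"

definition chart_domain ::
    "('i, 'a) pre_digraph \<Rightarrow> ('i \<Rightarrow> nat) \<Rightarrow> ('i \<Rightarrow> nat set) \<Rightarrow> ('i \<Rightarrow> 'f :: field vec set) set"
  where "chart_domain Q m S = {N. \<forall>i\<in>verts Q. \<forall>w\<in>carrier_vec (m i).
    \<exists>!v. v \<in> N i \<and> (\<forall>t\<in>S i. v $ t = w $ t)}"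

definition chart_coords ::
    "('i, 'a) pre_digraph \<Rightarrow> ('i \<Rightarrow> nat) \<Rightarrow> ('i \<Rightarrow> nat set) \<Rightarrow>
     (('i \<Rightarrow> 'f :: field vec set) \<Rightarrow> 'f) set"
  where "chart_coords Q m S =
    {(\<lambda>N. (THE v. v \<in> N i \<and> (\<forall>t\<in>S i. v $ t = (if t = s then 1 else 0))) $ r) | i s r.
      i \<in> verts Q \<and> s \<in> S i \<and> r < m i \<and> r \<notin> S i}"

definition quiver_grassmannian ::
    "('i, 'a) pre_digraph \<Rightarrow> ('a \<Rightarrow> 'k :: field mat) \<Rightarrow> ('i \<Rightarrow> nat) \<Rightarrow> ('i \<Rightarrow> nat) \<Rightarrow>
     ('i \<Rightarrow> 'k alg_closure vec set, 'k) kspace"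
  where "quiver_grassmannian Q A m e =
    glued_space ((\<lambda>S. (subrepresentations Q A m e \<inter> chart_domain Q m S, chart_coords Q m S))
      ` chart_indices Q m e)"


section \<open>The variety of framed representations and its group action\<close>

text \<open>We take \<open>U i = k\<^bsup>e i\<^esup>\<close>.\<close>

definition hom0_points ::
    "('i, 'a) pre_digraph \<Rightarrow> ('a \<Rightarrow> 'k :: field mat) \<Rightarrow> ('i \<Rightarrow> nat) \<Rightarrow> ('i \<Rightarrow> nat) \<Rightarrow>
     (('a \<Rightarrow> 'k alg_closure mat) \<times> ('i \<Rightarrow> 'k alg_closure mat)) set"
  where "hom0_points Q A m e =
    {(U, f). U \<in> (\<Pi>\<^sub>E \<alpha>\<in>arcs Q. carrier_mat (e (head Q \<alpha>)) (e (tail Q \<alpha>))) \<and>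
      f \<in> (\<Pi>\<^sub>E i\<in>verts Q. carrier_mat (m i) (e i)) \<and>
      (\<forall>i\<in>verts Q. inj_on (\<lambda>v. f i *\<^sub>v v) (carrier_vec (e i))) \<and>
      (\<forall>\<alpha>\<in>arcs Q. map_mat to_ac (A \<alpha>) * f (tail Q \<alpha>) = f (head Q \<alpha>) * U \<alpha>)}"

definition hom0_coords ::
    "('i, 'a) pre_digraph \<Rightarrow> ('i \<Rightarrow> nat) \<Rightarrow> ('i \<Rightarrow> nat) \<Rightarrow>
     (('a \<Rightarrow> 'f mat) \<times> ('i \<Rightarrow> 'f mat) \<Rightarrow> 'f) set"
  where "hom0_coords Q m e =
    {(\<lambda>(U, f). U \<alpha> $$ (r, c)) | \<alpha> r c.
      \<alpha> \<in> arcs Q \<and> r < e (head Q \<alpha>) \<and> c < e (tail Q \<alpha>)} \<union>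
    {(\<lambda>(U, f). f i $$ (r, c)) | i r c. i \<in> verts Q \<and> r < m i \<and> c < e i}"

definition hom0 ::
    "('i, 'a) pre_digraph \<Rightarrow> ('a \<Rightarrow> 'k :: field mat) \<Rightarrow> ('i \<Rightarrow> nat) \<Rightarrow> ('i \<Rightarrow> nat) \<Rightarrow>
     (('a \<Rightarrow> 'k alg_closure mat) \<times> ('i \<Rightarrow> 'k alg_closure mat), 'k) kspace"
  where "hom0 Q A m e = embedded_space (hom0_points Q A m e) (hom0_coords Q m e)"

definition GL_group :: "('i, 'a) pre_digraph \<Rightarrow> ('i \<Rightarrow> nat) \<Rightarrow> ('i \<Rightarrow> 'f :: field mat) monoid"
  where "GL_group Q e =
    \<lparr>carrier = (\<Pi>\<^sub>E i\<in>verts Q. {g \<in> carrier_mat (e i) (e i). invertible_mat g}),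
     monoid.mult = (\<lambda>g h. \<lambda>i\<in>verts Q. g i * h i),
     one = (\<lambda>i\<in>verts Q. 1\<^sub>m (e i))\<rparr>"

definition GL_act ::
    "('i, 'a) pre_digraph \<Rightarrow> ('i \<Rightarrow> nat) \<Rightarrow> ('i \<Rightarrow> 'f :: field mat) \<Rightarrow>
     ('a \<Rightarrow> 'f mat) \<times> ('i \<Rightarrow> 'f mat) \<Rightarrow> ('a \<Rightarrow> 'f mat) \<times> ('i \<Rightarrow> 'f mat)"
  where "GL_act Q e g = (\<lambda>(U, f).
    let h = inv\<^bsub>GL_group Q e\<^esub> g in
    (\<lambda>\<alpha>\<in>arcs Q. g (head Q \<alpha>) * U \<alpha> * h (tail Q \<alpha>), \<lambda>i\<in>verts Q. f i * h i))"

end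

theory Submission
  imports Defs "Jordan_Normal_Form.DL_Rank"
begin

text \<open>
  Two framed representations lie in the same orbit iff the maps \<open>f\<^sub>i\<close> have the same images, so
  orbits correspond to subrepresentations. On the chart of a family \<open>S\<close> of row sets, every
  subrepresentation is the image of a unique framed representation whose \<open>f\<^sub>i\<close> have the identity
  matrix in the rows \<open>S i\<close>. This section of the image map is polynomial in the chart coordinates;
  conversely the chart coordinates of an image are the entries of \<open>f\<^sub>i (f\<^sub>i|\<^sub>S)\<^sup>-\<^sup>1\<close>, hence regular
  where the minors do not vanish. Therefore the chart of the Grassmannian, the corresponding open
  part of the orbit space and the normalized slice are isomorphic. The slice is closed in an affine
  space, which makes the orbit space a prevariety; the other conditions for a geometric
  quotient hold for the orbit space by its definition.
\<close>

subsection \<open>Regular functions and morphisms\<close>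

text \<open>Injectivity of the frames f_i is an open condition, so framed representations form only
  a locally closed subset of affine space. Identity rows imply injectivity and are themselves
  equations; this is why normalized slices can be closed. On a slice the arrow maps are not free
  either: since f_j has identity rows at \<open>S j\<close>, the relation M_\<alpha> f_i = f_j
  U_\<alpha>, read in those rows, gives U_\<alpha> as the rows \<open>S j\<close> of M_\<alpha> f_i.
  Points have coordinates in K, but regular functions must be defined over k. All formulas used (row
  selection, minors, adjugates, the matrices of M) have coefficients in k. Functions on the orbit
  space are invariant functions upstairs, so a map out of it is a morphism as soon as its composite
  with the projection is one, while a local section followed by the projection gives a map into it.
  Hence the comparison needs only the image map, its local sections, and the fact that the orbits
  are the fibres of the image map.\<close>

lemma topspace_embedded_space [simp]: "points (embedded_space D C) = D"
proof -
  \<comment> \<open>The constant 1 vanishes nowhere, so \<open>D\<close> itself is one of the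
    generating open sets.\<close>
  have "(\<lambda>_. to_ac 1) \<in> kpoly C" by (rule kpoly.const)
  then have "D \<in> {{x \<in> D. p x \<noteq> 0} | p. p \<in> kpoly C}"
    by (intro CollectI exI[of _ "\<lambda>_. to_ac 1"]) auto
  then have "\<Union>{{x \<in> D. p x \<noteq> 0} | p. p \<in> kpoly C} = D" by blast
  then show ?thesis by (simp add: embedded_space_def Let_def)
qed

lemma openin_nonzero_kpoly:
  "p \<in> kpoly C \<Longrightarrow> openin (zariski (embedded_space D C)) {x \<in> D. p x \<noteq> 0}"
  by (auto simp: embedded_space_def Let_def intro!: topology_generated_by_Basis)

lemma regular_embedded_space:
  "h \<in> regular (embedded_space D C) U \<longleftrightarrow>
    (\<forall>x\<in>U. \<exists>W. openin (zariski (embedded_space D C)) W \<and> x \<in> W \<and> W \<subseteq> U \<and>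
        (\<exists>p\<in>kpoly C. \<exists>q\<in>kpoly C. \<forall>y\<in>W. q y \<noteq> 0 \<and> h y = p y / q y))"
  by (simp add: embedded_space_def Let_def)

lemma regular_cong:
  assumes "h \<in> regular (embedded_space D C) U" "\<And>x. x \<in> U \<Longrightarrow> h x = h' x"
  shows "h' \<in> regular (embedded_space D C) U"
  unfolding regular_embedded_space
proof
  fix x assume "x \<in> U"
  then obtain W p q where "openin (zariski (embedded_space D C)) W" "x \<in> W" "W \<subseteq> U"
    "p \<in> kpoly C" "q \<in> kpoly C" "\<forall>y\<in>W. q y \<noteq> 0 \<and> h y = p y / q y"
    using assms(1) unfolding regular_embedded_space by meson
  moreover from this have "\<forall>y\<in>W. q y \<noteq> 0 \<and> h' y = p y / q y"
    using assms(2) by (metis subsetD)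
  ultimately show "\<exists>W. openin (zariski (embedded_space D C)) W \<and> x \<in> W \<and> W \<subseteq> U \<and>
        (\<exists>p\<in>kpoly C. \<exists>q\<in>kpoly C. \<forall>y\<in>W. q y \<noteq> 0 \<and> h' y = p y / q y)"
    by blast
qed

lemma regular_kpoly:
  assumes "openin (zariski (embedded_space D C)) U" "p \<in> kpoly C"
  shows "p \<in> regular (embedded_space D C) U"
proof -
  have "(\<lambda>_. to_ac 1) \<in> kpoly C" by (rule kpoly.const)
  then show ?thesis
    unfolding regular_embedded_space using assms
    by (intro ballI exI[of _ U] conjI bexI[of _ p] bexI[of _ "\<lambda>_. to_ac 1"]) auto
qed

text \<open>Openness of \<open>W\<close> is implicit: regularity on a set containing
  \<open>x\<close> already supplies an open neighbourhood of \<open>x\<close> inside that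
  set.\<close>

lemma regular_local:
  assumes "\<And>x. x \<in> U \<Longrightarrow> \<exists>W. x \<in> W \<and> W \<subseteq> U \<and> h \<in> regular (embedded_space D C) W"
  shows "h \<in> regular (embedded_space D C) U"
  unfolding regular_embedded_space
proof
  fix x assume "x \<in> U"
  then obtain W where W: "x \<in> W" "W \<subseteq> U" "h \<in> regular (embedded_space D C) W"
    using assms by blast
  then obtain W' p q where "openin (zariski (embedded_space D C)) W'" "x \<in> W'" "W' \<subseteq> W"
    "p \<in> kpoly C" "q \<in> kpoly C" "\<forall>y\<in>W'. q y \<noteq> 0 \<and> h y = p y / q y"
    unfolding regular_embedded_space by meson
  then show "\<exists>W. openin (zariski (embedded_space D C)) W \<and> x \<in> W \<and> W \<subseteq> U \<and>
        (\<exists>p\<in>kpoly C. \<exists>q\<in>kpoly C. \<forall>y\<in>W. q y \<noteq> 0 \<and> h y = p y / q y)"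
    using W(2) by (meson subset_trans)
qed

lemma regular_restrict:
  assumes "h \<in> regular (embedded_space D C) U" "openin (zariski (embedded_space D C)) U'" "U' \<subseteq> U"
  shows "h \<in> regular (embedded_space D C) U'"
  unfolding regular_embedded_space
proof
  fix x assume x: "x \<in> U'"
  then obtain W p q where "openin (zariski (embedded_space D C)) W" "x \<in> W" "W \<subseteq> U"
    "p \<in> kpoly C" "q \<in> kpoly C" "\<forall>y\<in>W. q y \<noteq> 0 \<and> h y = p y / q y"
    using assms(1,3) unfolding regular_embedded_space by (meson subsetD)
  then show "\<exists>W. openin (zariski (embedded_space D C)) W \<and> x \<in> W \<and> W \<subseteq> U' \<and>
        (\<exists>p\<in>kpoly C. \<exists>q\<in>kpoly C. \<forall>y\<in>W. q y \<noteq> 0 \<and> h y = p y / q y)"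
    using x assms(2) by (intro exI[of _ "W \<inter> U'"]) (auto intro: openin_Int)
qed

text \<open>Puts two regular functions on one common neighbourhood as fractions, so that closure
  under ring operations and division becomes fraction arithmetic.\<close>

lemma regular_pair:
  assumes "h \<in> regular (embedded_space D C) U" "h' \<in> regular (embedded_space D C) U" "x \<in> U"
  obtains W p q p' q' where "openin (zariski (embedded_space D C)) W" "x \<in> W" "W \<subseteq> U"
    "p \<in> kpoly C" "q \<in> kpoly C" "\<And>y. y \<in> W \<Longrightarrow> q y \<noteq> 0 \<and> h y = p y / q y"
    "p' \<in> kpoly C" "q' \<in> kpoly C" "\<And>y. y \<in> W \<Longrightarrow> q' y \<noteq> 0 \<and> h' y = p' y / q' y"
proof -
  obtain W p q where 1: "openin (zariski (embedded_space D C)) W" "x \<in> W" "W \<subseteq> U"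
    "p \<in> kpoly C" "q \<in> kpoly C" "\<forall>y\<in>W. q y \<noteq> 0 \<and> h y = p y / q y"
    using assms(1,3) unfolding regular_embedded_space by meson
  obtain W' p' q' where 2: "openin (zariski (embedded_space D C)) W'" "x \<in> W'" "W' \<subseteq> U"
    "p' \<in> kpoly C" "q' \<in> kpoly C" "\<forall>y\<in>W'. q' y \<noteq> 0 \<and> h' y = p' y / q' y"
    using assms(2,3) unfolding regular_embedded_space by meson
  show thesis
    by (rule that[of "W \<inter> W'" p q p' q']) (use 1 2 in \<open>auto intro: openin_Int\<close>)
qed

lemma regular_add:
  assumes "h \<in> regular (embedded_space D C) U" "h' \<in> regular (embedded_space D C) U"
  shows "(\<lambda>x. h x + h' x) \<in> regular (embedded_space D C) U"
  unfolding regular_embedded_space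
proof
  fix x assume x: "x \<in> U"
  obtain W p q p' q' where
    *: "openin (zariski (embedded_space D C)) W" "x \<in> W" "W \<subseteq> U"
    "p \<in> kpoly C" "q \<in> kpoly C" "\<And>y. y \<in> W \<Longrightarrow> q y \<noteq> 0 \<and> h y = p y / q y"
    "p' \<in> kpoly C" "q' \<in> kpoly C" "\<And>y. y \<in> W \<Longrightarrow> q' y \<noteq> 0 \<and> h' y = p' y / q' y"
    by (rule regular_pair[OF assms x]) (rule that)
  show "\<exists>W. openin (zariski (embedded_space D C)) W \<and> x \<in> W \<and> W \<subseteq> U \<and>
        (\<exists>p\<in>kpoly C. \<exists>q\<in>kpoly C. \<forall>y\<in>W. q y \<noteq> 0 \<and> h y + h' y = p y / q y)"
    by (intro exI[of _ W] conjI bexI[of _ "\<lambda>y. p y * q' y + p' y * q y"]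
        bexI[of _ "\<lambda>y. q y * q' y"] ballI kpoly.add kpoly.mult *)
      (use *(6,9) in \<open>auto simp: add_frac_eq\<close>)
qed

lemma regular_mult:
  assumes "h \<in> regular (embedded_space D C) U" "h' \<in> regular (embedded_space D C) U"
  shows "(\<lambda>x. h x * h' x) \<in> regular (embedded_space D C) U"
  unfolding regular_embedded_space
proof
  fix x assume x: "x \<in> U"
  obtain W p q p' q' where
    *: "openin (zariski (embedded_space D C)) W" "x \<in> W" "W \<subseteq> U"
    "p \<in> kpoly C" "q \<in> kpoly C" "\<And>y. y \<in> W \<Longrightarrow> q y \<noteq> 0 \<and> h y = p y / q y"
    "p' \<in> kpoly C" "q' \<in> kpoly C" "\<And>y. y \<in> W \<Longrightarrow> q' y \<noteq> 0 \<and> h' y = p' y / q' y"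
    by (rule regular_pair[OF assms x]) (rule that)
  show "\<exists>W. openin (zariski (embedded_space D C)) W \<and> x \<in> W \<and> W \<subseteq> U \<and>
        (\<exists>p\<in>kpoly C. \<exists>q\<in>kpoly C. \<forall>y\<in>W. q y \<noteq> 0 \<and> h y * h' y = p y / q y)"
    by (intro exI[of _ W] conjI bexI[of _ "\<lambda>y. p y * p' y"]
        bexI[of _ "\<lambda>y. q y * q' y"] ballI kpoly.mult *)
      (use *(6,9) in auto)
qed

lemma regular_divide:
  assumes "h \<in> regular (embedded_space D C) U" "h' \<in> regular (embedded_space D C) U"
    "\<And>x. x \<in> U \<Longrightarrow> h' x \<noteq> 0"
  shows "(\<lambda>x. h x / h' x) \<in> regular (embedded_space D C) U"
  unfolding regular_embedded_space
proof
  fix x assume x: "x \<in> U"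
  obtain W p q p' q' where
    *: "openin (zariski (embedded_space D C)) W" "x \<in> W" "W \<subseteq> U"
    "p \<in> kpoly C" "q \<in> kpoly C" "\<And>y. y \<in> W \<Longrightarrow> q y \<noteq> 0 \<and> h y = p y / q y"
    "p' \<in> kpoly C" "q' \<in> kpoly C" "\<And>y. y \<in> W \<Longrightarrow> q' y \<noteq> 0 \<and> h' y = p' y / q' y"
    by (rule regular_pair[OF assms(1,2) x]) (rule that)
  \<comment> \<open>The quotient of the two fractions has denominator q p', and p' has no zero on
    \<open>W\<close> because \<open>h'\<close> = p' / q' has none.\<close>
  have "p' y \<noteq> 0" if "y \<in> W" for y using *(3,9) assms(3) that by fastforce
  then show "\<exists>W. openin (zariski (embedded_space D C)) W \<and> x \<in> W \<and> W \<subseteq> U \<and>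
        (\<exists>p\<in>kpoly C. \<exists>q\<in>kpoly C. \<forall>y\<in>W. q y \<noteq> 0 \<and> h y / h' y = p y / q y)"
    by (intro exI[of _ W] conjI bexI[of _ "\<lambda>y. p y * q' y"]
        bexI[of _ "\<lambda>y. q y * p' y"] ballI kpoly.mult *)
      (use *(6,9) in auto)
qed

lemma regular_const:
  "openin (zariski (embedded_space D C)) U \<Longrightarrow> (\<lambda>_. to_ac c) \<in> regular (embedded_space D C) U"
  by (rule regular_kpoly[OF _ kpoly.const])

lemma regular_sum:
  assumes "openin (zariski (embedded_space D C)) U"
    "\<And>i. i \<in> I \<Longrightarrow> h i \<in> regular (embedded_space D C) U"
  shows "(\<lambda>x. \<Sum>i\<in>I. h i x) \<in> regular (embedded_space D C) U"
  using assms(2)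
proof (induction I rule: infinite_finite_induct)
  \<comment> \<open>A sum over an infinite set is 0 by convention, and 0 is a constant from
    k.\<close>
  case (infinite I)
  then show ?case using regular_const[OF assms(1), of 0] by simp
next
  case empty
  then show ?case using regular_const[OF assms(1), of 0] by simp
next
  case (insert i I)
  then show ?case by (simp add: regular_add)
qed

lemma regular_prod:
  assumes "openin (zariski (embedded_space D C)) U"
    "\<And>i. i \<in> I \<Longrightarrow> h i \<in> regular (embedded_space D C) U"
  shows "(\<lambda>x. \<Prod>i\<in>I. h i x) \<in> regular (embedded_space D C) U"
  using assms(2)
proof (induction I rule: infinite_finite_induct)
  case (infinite I)
  then show ?case using regular_const[OF assms(1), of 1] by simp
next
  case empty
  then show ?case using regular_const[OF assms(1), of 1] by simp
next
  case (insert i I)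
  then show ?case by (simp add: regular_mult)
qed

lemma kpoly_sum:
  assumes "\<And>i. i \<in> I \<Longrightarrow> h i \<in> kpoly C"
  shows "(\<lambda>x. \<Sum>i\<in>I. h i x) \<in> kpoly C"
  using assms
proof (induction I rule: infinite_finite_induct)
  case (infinite I)
  then show ?case using kpoly.const[of 0] by simp
next
  case empty
  then show ?case using kpoly.const[of 0] by simp
next
  case (insert i I)
  then show ?case by (simp add: kpoly.add)
qed

lemma kpoly_diff:
  assumes "p \<in> kpoly C" "q \<in> kpoly C"
  shows "(\<lambda>x. p x - q x) \<in> kpoly C"
proof -
  \<comment> \<open>Subtraction is not a constructor of \<open>kpoly\<close>; it is addition of a
    multiple by the constant -1 of k.\<close>
  have "(\<lambda>x. p x + to_ac (- 1) * q x) \<in> kpoly C"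
    by (intro kpoly.add kpoly.mult kpoly.const assms)
  then show ?thesis by simp
qed

text \<open>Near each point \<open>h\<close> is a fraction, and its nonvanishing locus is that of
  the numerator, a basic open set.\<close>

lemma openin_nonzero_regular:
  assumes "openin (zariski (embedded_space D C)) U" "h \<in> regular (embedded_space D C) U"
  shows "openin (zariski (embedded_space D C)) {x \<in> U. h x \<noteq> 0}"
proof (subst openin_subopen, intro ballI)
  fix x assume x: "x \<in> {x \<in> U. h x \<noteq> 0}"
  then have "x \<in> U" by blast
  then obtain W p q where W: "openin (zariski (embedded_space D C)) W" "x \<in> W" "W \<subseteq> U"
    "p \<in> kpoly C" "q \<in> kpoly C" "\<forall>y\<in>W. q y \<noteq> 0 \<and> h y = p y / q y"
    using assms(2) unfolding regular_embedded_space by meson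
  have "openin (zariski (embedded_space D C)) (W \<inter> {x \<in> D. p x \<noteq> 0})"
    using W openin_nonzero_kpoly by (intro openin_Int) auto
  moreover have "x \<in> W \<inter> {x \<in> D. p x \<noteq> 0}"
    using x W openin_subset[OF W(1)] by auto
  moreover have "W \<inter> {x \<in> D. p x \<noteq> 0} \<subseteq> {x \<in> U. h x \<noteq> 0}"
    using W by auto
  ultimately show "\<exists>T. openin (zariski (embedded_space D C)) T \<and> x \<in> T \<and> T \<subseteq> {x \<in> U. h x \<noteq> 0}"
    by blast
qed

section \<open>Open subspaces, and morphisms tested on coordinates\<close>

lemma zariski_open_subspace [simp]: "zariski (open_subspace E U) = subtopology (zariski E) U"
  and regular_open_subspace [simp]: "regular (open_subspace E U) = regular E"
  by (simp_all add: open_subspace_def)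

lemma points_open_subspace: "openin (zariski E) U \<Longrightarrow> points (open_subspace E U) = U"
  using openin_subset by fastforce

lemma open_subspace_points [simp]: "open_subspace E (points E) = E"
  by (simp add: open_subspace_def subtopology_topspace)

lemma regular_pullback_kpoly:
  assumes "openin (zariski (embedded_space D C)) U"
    and "\<And>c. c \<in> C' \<Longrightarrow> c \<circ> \<phi> \<in> regular (embedded_space D C) U"
    and "p \<in> kpoly C'"
  shows "p \<circ> \<phi> \<in> regular (embedded_space D C) U"
  using assms(3)
proof induction
  case (const c)
  then show ?case using regular_const[OF assms(1), of c] by (simp add: comp_def)
next
  case (coord t)
  then show ?case using assms(2) by blast
next
  case (add p q)
  then show ?case using regular_add[of "p \<circ> \<phi>" D C U "q \<circ> \<phi>"] by (simp add: comp_def)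
next
  case (mult p q)
  then show ?case using regular_mult[of "p \<circ> \<phi>" D C U "q \<circ> \<phi>"] by (simp add: comp_def)
qed

text \<open>Regular coordinates suffice: polynomials then pull back to regular functions, whose
  nonvanishing loci are open, which gives continuity; and a local fraction pulls back to a quotient
  of regular functions with nonvanishing denominator. The source is an open subspace because chart
  coordinates of an image are regular only where the minors do not vanish.\<close>

lemma morphism_into_embedded_space:
  assumes U: "openin (zariski (embedded_space D C)) U"
    and into: "\<phi> ` U \<subseteq> D'"
    and coords: "\<And>c. c \<in> C' \<Longrightarrow> c \<circ> \<phi> \<in> regular (embedded_space D C) U"
  shows "morphism (open_subspace (embedded_space D C) U) (embedded_space D' C') \<phi>"
proof -
  let ?E = "embedded_space D C" and ?Y = "embedded_space D' C'"
  have UD: "U \<subseteq> D" using openin_subset[OF U] by simp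
  have pull: "p \<circ> \<phi> \<in> regular ?E U" if "p \<in> kpoly C'" for p
    using regular_pullback_kpoly[of D C U C' \<phi> p, OF U coords that] by blast
  have cont: "continuous_map (subtopology (zariski ?E) U) (zariski ?Y) \<phi>"
  proof -
    let ?B = "{{x \<in> D'. p x \<noteq> 0} | p. p \<in> kpoly C'}"
    have Z: "zariski ?Y = topology_generated_by ?B" by (simp add: embedded_space_def Let_def)
    have top: "\<Union>?B = D'" using topspace_embedded_space[of D' C'] unfolding Z by simp
    have "openin (subtopology (zariski ?E) U) (\<phi> -` {x \<in> D'. p x \<noteq> 0} \<inter> U)" if "p \<in> kpoly C'" for p
    proof -
      have "\<phi> -` {x \<in> D'. p x \<noteq> 0} \<inter> U = {x \<in> U. (p \<circ> \<phi>) x \<noteq> 0}" using into by auto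
      then show ?thesis using openin_nonzero_regular[OF U pull[OF that]] U
        by (simp add: openin_open_subtopology)
    qed
    moreover have "topspace (subtopology (zariski ?E) U) = U" using UD by auto
    ultimately show ?thesis
      unfolding Z continuous_on_generated_topo_iff top using into by auto
  qed
  have "h \<circ> \<phi> \<in> regular ?E {x \<in> U. \<phi> x \<in> V}"
    if V: "openin (zariski ?Y) V" and h: "h \<in> regular ?Y V" for V h
  proof (rule regular_local)
    fix x assume x: "x \<in> {x \<in> U. \<phi> x \<in> V}"
    then have "\<phi> x \<in> V" by blast
    then obtain W p q where W: "openin (zariski ?Y) W" "\<phi> x \<in> W" "W \<subseteq> V"
      "p \<in> kpoly C'" "q \<in> kpoly C'" "\<forall>y\<in>W. q y \<noteq> 0 \<and> h y = p y / q y"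
      using h unfolding regular_embedded_space by meson
    let ?W = "{x \<in> U. \<phi> x \<in> W}"
    have "openin (subtopology (zariski ?E) U) {x \<in> topspace (subtopology (zariski ?E) U). \<phi> x \<in> W}"
      using cont W(1) by (rule openin_continuous_map_preimage)
    moreover have "topspace (subtopology (zariski ?E) U) = U" using UD by auto
    ultimately have "openin (subtopology (zariski ?E) U) ?W" by metis
    then have oW: "openin (zariski ?E) ?W"
      using U by (simp add: openin_open_subtopology)
    have "(\<lambda>x. (p \<circ> \<phi>) x / (q \<circ> \<phi>) x) \<in> regular ?E ?W"
      by (rule regular_divide; (rule regular_restrict[OF pull oW])?) (use W in auto)
    then have "h \<circ> \<phi> \<in> regular ?E ?W"
      by (rule regular_cong) (use W in auto)
    then show "\<exists>W. x \<in> W \<and> W \<subseteq> {x \<in> U. \<phi> x \<in> V} \<and> h \<circ> \<phi> \<in> regular ?E W"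
      using x W by (intro exI[of _ ?W]) auto
  qed
  moreover have "topspace (subtopology (zariski ?E) U) = U" using UD by auto
  ultimately show ?thesis using cont by (simp add: morphism_def)
qed

lemma morphism_embedded_space:
  assumes "\<phi> ` D \<subseteq> D'" "\<And>c. c \<in> C' \<Longrightarrow> c \<circ> \<phi> \<in> regular (embedded_space D C) D"
  shows "morphism (embedded_space D C) (embedded_space D' C') \<phi>"
proof -
  have "openin (zariski (embedded_space D C)) D"
    by (metis openin_topspace topspace_embedded_space)
  from morphism_into_embedded_space[of D C D \<phi> D' C', OF this] assms show ?thesis
    using open_subspace_points[of "embedded_space D C"] by simp
qed

lemma openin_embedded_space_self [simp]: "openin (zariski (embedded_space D C)) D"
  by (metis openin_topspace topspace_embedded_space)

lemma morphism_continuous: "morphism E Y \<phi> \<Longrightarrow> continuous_map (zariski E) (zariski Y) \<phi>"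
  by (simp add: morphism_def)

lemma morphism_regular:
  "morphism E Y \<phi> \<Longrightarrow> openin (zariski Y) V \<Longrightarrow> h \<in> regular Y V \<Longrightarrow>
    h \<circ> \<phi> \<in> regular E {x \<in> points E. \<phi> x \<in> V}"
  by (simp add: morphism_def)

lemma morphism_image: "morphism E Y \<phi> \<Longrightarrow> x \<in> points E \<Longrightarrow> \<phi> x \<in> points Y"
  using morphism_continuous continuous_map_image_subset_topspace by fast

lemma morphism_openin:
  "morphism E Y \<phi> \<Longrightarrow> openin (zariski Y) V \<Longrightarrow> openin (zariski E) {x \<in> points E. \<phi> x \<in> V}"
  using openin_continuous_map_preimage morphism_continuous by blast

lemma morphism_compose:
  assumes "morphism E Y \<phi>" "morphism Y Z \<psi>"
  shows "morphism E Z (\<psi> \<circ> \<phi>)"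
  unfolding morphism_def
proof (intro conjI allI impI ballI)
  show "continuous_map (zariski E) (zariski Z) (\<psi> \<circ> \<phi>)"
    by (rule continuous_map_compose[OF assms[THEN morphism_continuous]])
next
  fix V h assume V: "openin (zariski Z) V" and h: "h \<in> regular Z V"
  let ?V = "{y \<in> points Y. \<psi> y \<in> V}"
  have "(h \<circ> \<psi>) \<circ> \<phi> \<in> regular E {x \<in> points E. \<phi> x \<in> ?V}"
    by (intro morphism_regular[OF assms(1)] morphism_openin[OF assms(2)]
        morphism_regular[OF assms(2)] V h)
  moreover have "{x \<in> points E. \<phi> x \<in> ?V} = {x \<in> points E. (\<psi> \<circ> \<phi>) x \<in> V}"
    using morphism_image[OF assms(1)] by auto
  ultimately show "h \<circ> (\<psi> \<circ> \<phi>) \<in> regular E {x \<in> points E. (\<psi> \<circ> \<phi>) x \<in> V}"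
    by (simp only: o_assoc)
qed

lemma isomorphic_trans:
  assumes "isomorphic E Y" "isomorphic Y Z"
  shows "isomorphic E Z"
proof -
  obtain \<phi> \<psi> where 1: "morphism E Y \<phi>" "morphism Y E \<psi>"
    "\<forall>x\<in>points E. \<psi> (\<phi> x) = x" "\<forall>y\<in>points Y. \<phi> (\<psi> y) = y"
    using assms(1) unfolding isomorphic_def by blast
  obtain \<phi>' \<psi>' where 2: "morphism Y Z \<phi>'" "morphism Z Y \<psi>'"
    "\<forall>x\<in>points Y. \<psi>' (\<phi>' x) = x" "\<forall>y\<in>points Z. \<phi>' (\<psi>' y) = y"
    using assms(2) unfolding isomorphic_def by blast
  have "\<forall>x\<in>points E. (\<psi> \<circ> \<psi>') ((\<phi>' \<circ> \<phi>) x) = x"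
    using 1 2 morphism_image[OF 1(1)] by auto
  moreover have "\<forall>z\<in>points Z. (\<phi>' \<circ> \<phi>) ((\<psi> \<circ> \<psi>') z) = z"
    using 1(4) 2(4) morphism_image[OF 2(2)] by simp
  ultimately show ?thesis
    unfolding isomorphic_def using morphism_compose[OF 1(1) 2(1)] morphism_compose[OF 2(2) 1(2)]
    by (intro exI[of _ "\<phi>' \<circ> \<phi>"] exI[of _ "\<psi> \<circ> \<psi>'"] conjI)
qed

lemma morphism_cong:
  assumes "morphism (embedded_space D C) Y \<phi>" "\<And>x. x \<in> D \<Longrightarrow> \<phi> x = \<psi> x"
  shows "morphism (embedded_space D C) Y \<psi>"
  unfolding morphism_def
proof (intro conjI allI impI ballI)
  show "continuous_map (zariski (embedded_space D C)) (zariski Y) \<psi>"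
    by (rule continuous_map_eq[OF morphism_continuous[OF assms(1)]]) (simp add: assms(2))
  fix V h assume "openin (zariski Y) V" "h \<in> regular Y V"
  then have "h \<circ> \<phi> \<in> regular (embedded_space D C) {x \<in> points (embedded_space D C). \<phi> x \<in> V}"
    by (rule morphism_regular[OF assms(1)])
  moreover have "{x \<in> points (embedded_space D C). \<phi> x \<in> V} = {x \<in> points (embedded_space D C). \<psi> x \<in> V}"
    using assms(2) by auto
  ultimately have "h \<circ> \<phi> \<in> regular (embedded_space D C) {x \<in> points (embedded_space D C). \<psi> x \<in> V}"
    by metis
  then show "h \<circ> \<psi> \<in> regular (embedded_space D C) {x \<in> points (embedded_space D C). \<psi> x \<in> V}"
    by (elim regular_cong) (auto simp: assms(2))
qed

lemma morphism_into_open_subspace: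
  assumes "morphism E Y \<phi>" "openin (zariski Y) U" "\<phi> ` points E \<subseteq> U"
  shows "morphism E (open_subspace Y U) \<phi>"
  using assms unfolding morphism_def
  by (auto simp: continuous_map_in_subtopology openin_open_subtopology)

section \<open>Glued spaces\<close>

lemma regular_glued_space:
  "h \<in> regular (glued_space \<A>) W \<longleftrightarrow> (\<forall>(D, C)\<in>\<A>. h \<in> regular (embedded_space D C) (W \<inter> D))"
  by (simp add: glued_space_def)

lemma points_glued_space: "points (glued_space \<A>) = (\<Union>(D, C)\<in>\<A>. D)"
proof
  show "points (glued_space \<A>) \<subseteq> (\<Union>(D, C)\<in>\<A>. D)"
    using openin_glued_space openin_topspace by metis
  have "(\<Union>(D, C)\<in>\<A>. D) \<inter> D = D" if "(D, C) \<in> \<A>" for D C using that by blast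
  then have "openin (zariski (glued_space \<A>)) (\<Union>(D, C)\<in>\<A>. D)"
    unfolding openin_glued_space by auto
  then show "(\<Union>(D, C)\<in>\<A>. D) \<subseteq> points (glued_space \<A>)" by (rule openin_subset)
qed

text \<open>Topology and functions of a glued space are defined by restriction to the pieces, so
  maps out of it are tested piece by piece. Maps into it have no such criterion; the image map into
  the Grassmannian is therefore treated separately in \<open>morphism_im\<close>.\<close>

lemma morphism_from_glued_space:
  assumes "\<And>D C. (D, C) \<in> \<A> \<Longrightarrow> morphism (embedded_space D C) Y \<phi>"
  shows "morphism (glued_space \<A>) Y \<phi>"
proof -
  note top = points_glued_space[of \<A>]
  have pre: "{x \<in> points (glued_space \<A>). \<phi> x \<in> V} \<inter> D = {x \<in> D. \<phi> x \<in> V}"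
    if "(D, C) \<in> \<A>" for D C V using that unfolding top by auto
  have "continuous_map (zariski (glued_space \<A>)) (zariski Y) \<phi>"
    unfolding continuous_map_def
  proof (intro conjI allI impI)
    show "\<phi> \<in> points (glued_space \<A>) \<rightarrow> points Y"
      unfolding top using morphism_image[OF assms] by auto
    fix V assume V: "openin (zariski Y) V"
    have "openin (zariski (embedded_space D C)) {x \<in> D. \<phi> x \<in> V}" if "(D, C) \<in> \<A>" for D C
      using assms[OF that] V unfolding morphism_def continuous_map_def by simp
    then show "openin (zariski (glued_space \<A>)) {x \<in> points (glued_space \<A>). \<phi> x \<in> V}"
      unfolding openin_glued_space using pre by (auto simp: top)
  qed
  moreover have "h \<circ> \<phi> \<in> regular (glued_space \<A>) {x \<in> points (glued_space \<A>). \<phi> x \<in> V}"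
    if "openin (zariski Y) V" "h \<in> regular Y V" for V h
  proof -
    have "h \<circ> \<phi> \<in> regular (embedded_space D C) {x \<in> D. \<phi> x \<in> V}" if "(D, C) \<in> \<A>" for D C
      using assms[OF that] \<open>openin (zariski Y) V\<close> \<open>h \<in> regular Y V\<close>
      unfolding morphism_def by simp
    then have "h \<circ> \<phi> \<in> regular (embedded_space D C)
        ({x \<in> points (glued_space \<A>). \<phi> x \<in> V} \<inter> D)" if "(D, C) \<in> \<A>" for D C
      using that pre[OF that] by metis
    then show ?thesis unfolding regular_glued_space by blast
  qed
  ultimately show ?thesis unfolding morphism_def by blast
qed

section \<open>Closed subsets of affine space\<close>

lemma kpoly_pullback:
  assumes "p \<in> kpoly C" "\<And>c. c \<in> C \<Longrightarrow> \<exists>q\<in>kpoly C'. \<forall>x\<in>D. q (\<phi> x) = c x"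
  shows "\<exists>q\<in>kpoly C'. \<forall>x\<in>D. q (\<phi> x) = p x"
  using assms(1)
proof induction
  case (const c)
  then show ?case by (intro bexI[OF _ kpoly.const[of c]]) simp
next
  case (coord t)
  then show ?case by (rule assms(2))
next
  case (add p q)
  then obtain p' q' where "p' \<in> kpoly C'" "q' \<in> kpoly C'"
    "\<forall>x\<in>D. p' (\<phi> x) = p x" "\<forall>x\<in>D. q' (\<phi> x) = q x" by blast
  then show ?case by (intro bexI[OF _ kpoly.add[of p' _ q']]) simp_all
next
  case (mult p q)
  then obtain p' q' where "p' \<in> kpoly C'" "q' \<in> kpoly C'"
    "\<forall>x\<in>D. p' (\<phi> x) = p x" "\<forall>x\<in>D. q' (\<phi> x) = q x" by blast
  then show ?case by (intro bexI[OF _ kpoly.mult[of p' _ q']]) simp_all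
qed

text \<open>\<open>B\<close> is an affine space in disguise: by \<open>inj\<close> and
  \<open>surj\<close> the functions \<open>c\<close> are its coordinates, indexed by an arbitrary
  finite set such as the entries of several matrices. The hypothesis \<open>closed\<close> says that
  \<open>D\<close> is Zariski closed in \<open>B\<close> over k, as every outside point is separated
  from \<open>D\<close> by a polynomial. Numbering the coordinates then identifies \<open>D\<close>
  with a closed subset of standard affine space.\<close>

lemma closed_embedded_space_affine:
  fixes c :: "'j \<Rightarrow> 'x \<Rightarrow> 'k :: field alg_closure"
  assumes fin: "finite I" and DB: "D \<subseteq> B"
    and inj: "\<And>x y. x \<in> B \<Longrightarrow> y \<in> B \<Longrightarrow> (\<And>j. j \<in> I \<Longrightarrow> c j x = c j y) \<Longrightarrow> x = y"
    and surj: "\<And>a. \<exists>x\<in>B. \<forall>j\<in>I. c j x = a j"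
    and closed: "\<And>x. x \<in> B - D \<Longrightarrow> \<exists>p\<in>kpoly (c ` I). p x \<noteq> 0 \<and> (\<forall>y\<in>D. p y = 0)"
  shows "\<exists>n F. F \<subseteq> kpoly (affine_coords n) \<and>
    isomorphic (embedded_space D (c ` I)) (affine_variety n F)"
proof -
  obtain \<iota> where \<iota>: "bij_betw \<iota> {..<card I} I"
    using ex_bij_betw_nat_finite[OF fin] by (auto simp: atLeast0LessThan)
  define n where "n = card I"
  define \<beta> where "\<beta> = (\<lambda>x. vec n (\<lambda>k. c (\<iota> k) x))"
  \<comment> \<open>The full ideal of polynomials vanishing on the image; no finite system of
    equations has to be chosen.\<close>
  define F where "F = {q \<in> kpoly (affine_coords n). \<forall>x\<in>D. q (\<beta> x) = 0}"
  have \<iota>_ex: "\<exists>k<n. \<iota> k = j" if "j \<in> I" for j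
    using \<iota> that unfolding n_def bij_betw_def by (metis imageE lessThan_iff)
  have \<beta>_inj: "x = y" if "x \<in> B" "y \<in> B" "\<beta> x = \<beta> y" for x y
  proof (rule inj[OF that(1,2)])
    fix j assume "j \<in> I"
    then obtain k where "k < n" "\<iota> k = j" using \<iota>_ex by blast
    then show "c j x = c j y" using arg_cong[OF that(3), of "\<lambda>v. vec_index v k"] by (simp add: \<beta>_def)
  qed
  have \<beta>_surj: "\<exists>x\<in>B. \<beta> x = v" if "v \<in> carrier_vec n" for v
  proof -
    obtain x where x: "x \<in> B" "\<forall>j\<in>I. c j x = v $ (inv_into {..<n} \<iota> j)"
      using surj[of "\<lambda>j. v $ (inv_into {..<n} \<iota> j)"] by blast
    have "\<beta> x = v"
    proof (rule eq_vecI)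
      fix k assume "k < dim_vec v"
      then have k: "k < n" using that by simp
      then have "\<iota> k \<in> I" using \<iota> by (auto simp: n_def bij_betw_def)
      moreover have "inv_into {..<n} \<iota> (\<iota> k) = k"
        using \<iota> k by (simp add: n_def bij_betw_def)
      ultimately show "\<beta> x $ k = v $ k" using x(2) k by (simp add: \<beta>_def)
    qed (use that in \<open>simp add: \<beta>_def\<close>)
    then show ?thesis using x(1) by blast
  qed
  have coord_\<beta>: "\<exists>q\<in>kpoly (affine_coords n). \<forall>x\<in>UNIV. q (\<beta> x) = t x" if t: "t \<in> c ` I" for t
  proof -
    obtain j where "j \<in> I" "t = c j" using t by blast
    then obtain k where k: "k < n" "\<iota> k = j" using \<iota>_ex by blast
    then have "(\<lambda>v. v $ k) \<in> kpoly (affine_coords n :: ('k alg_closure vec \<Rightarrow> _) set)"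
      by (auto simp: affine_coords_def intro: kpoly.coord)
    then show ?thesis using k \<open>t = c j\<close> by (intro bexI[of _ "\<lambda>v :: 'k alg_closure vec. v $ k"]) (simp_all add: \<beta>_def)
  qed
  let ?D' = "{v \<in> carrier_vec n. \<forall>q\<in>F. q v = 0}"
  have image: "\<beta> ` D = ?D'"
  proof
    show "\<beta> ` D \<subseteq> ?D'" by (auto simp: F_def \<beta>_def)
    show "?D' \<subseteq> \<beta> ` D"
    proof
      fix v assume v: "v \<in> ?D'"
      then obtain x where x: "x \<in> B" "\<beta> x = v" using \<beta>_surj by blast
      \<comment> \<open>Otherwise the separating polynomial, rewritten in the numbered coordinates,
        would belong to \<open>F\<close> without vanishing at \<open>v\<close>.\<close>
      have "x \<in> D"
      proof (rule ccontr)
        assume "x \<notin> D"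
        then obtain p where p: "p \<in> kpoly (c ` I)" "p x \<noteq> 0" "\<forall>y\<in>D. p y = 0"
          using closed x(1) by blast
        obtain q where "q \<in> kpoly (affine_coords n)" "\<forall>x\<in>UNIV. q (\<beta> x) = p x"
          using kpoly_pullback[OF p(1) coord_\<beta>] by blast
        moreover from this have "q \<in> F" using p(3) by (simp add: F_def)
        ultimately show False using v x(2) p(2) by auto
      qed
      then show "v \<in> \<beta> ` D" using x(2) by blast
    qed
  qed
  have \<beta>_injD: "inj_on \<beta> D" using \<beta>_inj DB by (auto intro!: inj_onI)
  have "morphism (embedded_space D (c ` I)) (embedded_space ?D' (affine_coords n)) \<beta>"
  proof (rule morphism_embedded_space)
    show "\<beta> ` D \<subseteq> ?D'" using image by simp
    fix t :: "'k alg_closure vec \<Rightarrow> 'k alg_closure" assume "t \<in> affine_coords n"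
    then obtain k where k: "k < n" "t = (\<lambda>v. v $ k)" by (auto simp: affine_coords_def)
    then have "t \<circ> \<beta> = c (\<iota> k)" by (auto simp: \<beta>_def)
    moreover have "\<iota> k \<in> I" using \<iota> k(1) by (auto simp: n_def bij_betw_def)
    ultimately show "t \<circ> \<beta> \<in> regular (embedded_space D (c ` I)) D"
      by (auto intro!: regular_kpoly kpoly.coord)
  qed
  moreover have "morphism (embedded_space ?D' (affine_coords n)) (embedded_space D (c ` I)) (inv_into D \<beta>)"
  proof (rule morphism_embedded_space)
    show "inv_into D \<beta> ` ?D' \<subseteq> D" unfolding image[symmetric] by (auto simp: inv_into_into)
    fix t assume "t \<in> c ` I"
    then obtain q where q: "q \<in> kpoly (affine_coords n)" "\<forall>x\<in>UNIV. q (\<beta> x) = t x"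
      using coord_\<beta> by blast
    have "q \<in> regular (embedded_space ?D' (affine_coords n)) ?D'"
      using q(1) by (intro regular_kpoly) simp_all
    then show "t \<circ> inv_into D \<beta> \<in> regular (embedded_space ?D' (affine_coords n)) ?D'"
    proof (rule regular_cong)
      fix v assume "v \<in> ?D'"
      then have "v \<in> \<beta> ` D" using image by simp
      then show "q v = (t \<circ> inv_into D \<beta>) v" using q(2) by (metis UNIV_I comp_apply f_inv_into_f)
    qed
  qed
  ultimately have "isomorphic (embedded_space D (c ` I)) (affine_variety n F)"
    unfolding isomorphic_def affine_variety_def
  proof (intro exI[of _ \<beta>] exI[of _ "inv_into D \<beta>"] conjI ballI)
    fix x assume "x \<in> points (embedded_space D (c ` I))"
    then show "inv_into D \<beta> (\<beta> x) = x" using \<beta>_injD by simp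
  next
    fix v assume "v \<in> points (embedded_space ?D' (affine_coords n))"
    then have "v \<in> \<beta> ` D" using image by simp
    then show "\<beta> (inv_into D \<beta> v) = v" by (rule f_inv_into_f)
  qed
  moreover have "F \<subseteq> kpoly (affine_coords n)" by (auto simp: F_def)
  ultimately show ?thesis by blast
qed

subsection \<open>Orbit spaces with local sections\<close>

lemma points_orbit_space [simp]:
  "points (orbit_space G act E) = Group_Action.orbits G (points E) act"
proof
  show "points (orbit_space G act E) \<subseteq> Group_Action.orbits G (points E) act"
    using openin_orbit_space openin_topspace by metis
  have "{x \<in> points E. Group_Action.orbit G act x \<in> Group_Action.orbits G (points E) act} = points E"
    by (auto simp: Group_Action.orbits_def)
  then have "openin (zariski (orbit_space G act E)) (Group_Action.orbits G (points E) act)"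
    unfolding openin_orbit_space by simp
  then show "Group_Action.orbits G (points E) act \<subseteq> points (orbit_space G act E)"
    by (rule openin_subset)
qed

lemma regular_orbit_space:
  "h \<in> regular (orbit_space G act E) W \<longleftrightarrow>
    h \<circ> Group_Action.orbit G act \<in> regular E {x \<in> points E. Group_Action.orbit G act x \<in> W}"
  by (simp add: orbit_space_def comp_def)

lemma morphism_orbit: "morphism E (orbit_space G act E) (Group_Action.orbit G act)"
  unfolding morphism_def continuous_map_def
  by (auto simp: openin_orbit_space regular_orbit_space Group_Action.orbits_def)

text \<open>Universal property of the orbit space: openness and regularity on it are defined by
  pullback along the projection, so \<open>b\<close> inherits both from its composite with the
  projection. The version over an open \<open>U\<close> is what the chart maps require, since
  normalization is only defined over a chart.\<close>

lemma morphism_from_orbit_space: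
  fixes act :: "'g \<Rightarrow> 'x \<Rightarrow> 'x"
  assumes U: "openin (zariski (orbit_space G act E)) U"
    and mor: "morphism (open_subspace E {x \<in> points E. Group_Action.orbit G act x \<in> U}) Y
      (b \<circ> Group_Action.orbit G act)"
  shows "morphism (open_subspace (orbit_space G act E) U) Y b"
proof -
  let ?\<pi> = "Group_Action.orbit G act"
  let ?X = "{x \<in> points E. ?\<pi> x \<in> U}"
  have X: "openin (zariski E) ?X" using U unfolding openin_orbit_space by blast
  note pX = points_open_subspace[OF X] and pU = points_open_subspace[OF U]
  have pre: "{x \<in> points E. ?\<pi> x \<in> {y \<in> U. b y \<in> V}} = {x \<in> ?X. (b \<circ> ?\<pi>) x \<in> V}" for V by auto
  have "continuous_map (zariski (open_subspace (orbit_space G act E) U)) (zariski Y) b"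
    unfolding continuous_map_def pU
  proof (intro conjI allI impI)
    show "b \<in> U \<rightarrow> points Y"
    proof
      fix y assume y: "y \<in> U"
      then have "y \<in> Group_Action.orbits G (points E) act" using U openin_orbit_space by blast
      then obtain x where x: "x \<in> points E" "y = ?\<pi> x" by (auto simp: Group_Action.orbits_def)
      then have "x \<in> points (open_subspace E ?X)" using y pX by blast
      then show "b y \<in> points Y" using morphism_image[OF mor] x by fastforce
    qed
    fix V assume "openin (zariski Y) V"
    then have "openin (zariski (open_subspace E ?X)) {x \<in> ?X. (b \<circ> ?\<pi>) x \<in> V}"
      using morphism_openin[OF mor] unfolding pX by blast
    then have "openin (zariski E) {x \<in> ?X. (b \<circ> ?\<pi>) x \<in> V}"
      using X by (simp add: openin_open_subtopology)
    then have "openin (zariski (orbit_space G act E)) {y \<in> U. b y \<in> V}"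
      using openin_subset[OF U] unfolding openin_orbit_space pre by auto
    then show "openin (zariski (open_subspace (orbit_space G act E) U)) {y \<in> U. b y \<in> V}"
      using U by (simp add: openin_open_subtopology)
  qed
  moreover have "h \<circ> b \<in> regular (open_subspace (orbit_space G act E) U) {y \<in> U. b y \<in> V}"
    if "openin (zariski Y) V" "h \<in> regular Y V" for V h
    using morphism_regular[OF mor that]
    unfolding regular_open_subspace regular_orbit_space pre pX by (simp only: o_assoc)
  ultimately show ?thesis unfolding morphism_def pU by blast
qed

text \<open>Isolates what the geometric argument uses, free of matrices: the orbits are the fibres
  of \<open>im\<close>, finitely many sets \<open>D S\<close> cover its values, and over each of
  them \<open>im\<close> has a section \<open>sec S\<close>, both regular in the coordinates
  \<open>CC S\<close>. Openness is required only of the preimages of the \<open>D S\<close>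
  upstairs. Affineness is required of the image of the section, because equations are available for
  the slice rather than for the set of subspaces \<open>D S\<close>.\<close>

locale quotient_atlas =
  fixes G :: "('g, 'm) monoid_scheme" and act :: "'g \<Rightarrow> 'x \<Rightarrow> 'x"
    and E :: "'x set" and C :: "('x \<Rightarrow> 'k :: field alg_closure) set" and im :: "'x \<Rightarrow> 'y"
    and \<S> :: "'s set" and D :: "'s \<Rightarrow> 'y set" and CC :: "'s \<Rightarrow> ('y \<Rightarrow> 'k alg_closure) set"
    and sec :: "'s \<Rightarrow> 'y \<Rightarrow> 'x"
  assumes act_closed: "\<And>g x. g \<in> carrier G \<Longrightarrow> x \<in> E \<Longrightarrow> act g x \<in> E"
    and orbit_eq: "\<And>x. x \<in> E \<Longrightarrow> Group_Action.orbit G act x = {y \<in> E. im y = im x}"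
    and finite_charts: "finite \<S>"
    and cover: "\<And>x. x \<in> E \<Longrightarrow> \<exists>S\<in>\<S>. im x \<in> D S"
    and sec_in: "\<And>S N. S \<in> \<S> \<Longrightarrow> N \<in> D S \<Longrightarrow> sec S N \<in> E"
    and im_sec: "\<And>S N. S \<in> \<S> \<Longrightarrow> N \<in> D S \<Longrightarrow> im (sec S N) = N"
    and open_chart: "\<And>S. S \<in> \<S> \<Longrightarrow> openin (zariski (embedded_space E C)) {x \<in> E. im x \<in> D S}"
    and sec_coords: "\<And>S c. S \<in> \<S> \<Longrightarrow> c \<in> C \<Longrightarrow> c \<circ> sec S \<in> regular (embedded_space (D S) (CC S)) (D S)"
    and im_coords: "\<And>S c. S \<in> \<S> \<Longrightarrow> c \<in> CC S \<Longrightarrow>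
      c \<circ> im \<in> regular (embedded_space E C) {x \<in> E. im x \<in> D S}"
    and affine_slice: "\<And>S. S \<in> \<S> \<Longrightarrow> \<exists>n F. F \<subseteq> kpoly (affine_coords n) \<and>
      isomorphic (embedded_space (sec S ` D S) C) (affine_variety n F)"
begin

abbreviation "H \<equiv> embedded_space E C"
abbreviation "quot \<equiv> orbit_space G act H"
abbreviation "\<pi> \<equiv> Group_Action.orbit G act"
abbreviation "HS S \<equiv> {x \<in> E. im x \<in> D S}"
abbreviation "gr \<equiv> glued_space ((\<lambda>S. (D S, CC S)) ` \<S>)"

text \<open>Inverse of the bijection \<open>N \<mapsto> {x \<in> E. im x = N}\<close> onto the orbits.\<close>

definition "pt y = im (SOME x. x \<in> y)"

lemma pt_orbit: "x \<in> E \<Longrightarrow> pt (\<pi> x) = im x"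
  unfolding pt_def orbit_eq using someI[of "\<lambda>y. y \<in> {y \<in> E. im y = im x}" x] by simp

lemma orbit_eq_iff: "x \<in> E \<Longrightarrow> y \<in> E \<Longrightarrow> \<pi> x = \<pi> y \<longleftrightarrow> im x = im y"
  by (metis orbit_eq pt_orbit)

text \<open>Saturation: \<open>HS S\<close> is defined through \<open>im\<close>, whose fibres are
  the orbits.\<close>

lemma preimage_chart: "{x \<in> points H. \<pi> x \<in> \<pi> ` HS S} = HS S"
  by (auto simp: orbit_eq_iff)

lemma openin_quot_chart: "S \<in> \<S> \<Longrightarrow> openin (zariski quot) (\<pi> ` HS S)"
  unfolding openin_orbit_space preimage_chart using open_chart
  by (auto simp: Group_Action.orbits_def)

lemma morphism_im_chart:
  "S \<in> \<S> \<Longrightarrow> morphism (open_subspace H (HS S)) (embedded_space (D S) (CC S)) im"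
  by (rule morphism_into_embedded_space) (auto intro: open_chart im_coords)

lemma morphism_sec: "S \<in> \<S> \<Longrightarrow> morphism (embedded_space (D S) (CC S)) H (sec S)"
  by (rule morphism_embedded_space) (auto intro: sec_in sec_coords)

text \<open>Each orbit over the chart meets the slice in exactly one point, the value of
  \<open>sec S\<close> at the common image of the orbit. Normalization
  \<open>sec S \<circ> pt\<close> is a morphism because upstairs it becomes
  \<open>sec S \<circ> im\<close>; its inverse is the inclusion of the slice followed by the
  projection.\<close>

lemma isomorphic_quot_chart:
  assumes S: "S \<in> \<S>"
  shows "isomorphic (open_subspace quot (\<pi> ` HS S)) (embedded_space (sec S ` D S) C)"
proof -
  let ?\<Sigma> = "embedded_space (sec S ` D S) C"
  have sec_sub: "sec S ` D S \<subseteq> E" using sec_in[OF S] by blast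
  have "morphism (open_subspace H (HS S)) ?\<Sigma> ((sec S \<circ> pt) \<circ> \<pi>)"
  proof (rule morphism_into_embedded_space[OF open_chart[OF S]])
    show "((sec S \<circ> pt) \<circ> \<pi>) ` HS S \<subseteq> sec S ` D S" by (auto simp: pt_orbit)
    fix c assume "c \<in> C"
    then have "(c \<circ> sec S) \<circ> im \<in> regular (open_subspace H (HS S)) {x \<in> points (open_subspace H (HS S)). im x \<in> D S}"
      by (intro morphism_regular[OF morphism_im_chart[OF S]] sec_coords S) simp_all
    then have "(c \<circ> sec S) \<circ> im \<in> regular H (HS S)"
      by (simp add: points_open_subspace[OF open_chart[OF S]] del: zariski_open_subspace)
    then show "c \<circ> ((sec S \<circ> pt) \<circ> \<pi>) \<in> regular H (HS S)"
      by (rule regular_cong) (simp add: pt_orbit)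
  qed
  then have 1: "morphism (open_subspace quot (\<pi> ` HS S)) ?\<Sigma> (sec S \<circ> pt)"
    by (intro morphism_from_orbit_space[OF openin_quot_chart[OF S]]) (simp only: preimage_chart)
  have "morphism ?\<Sigma> H id"
    by (rule morphism_embedded_space) (use sec_sub in \<open>auto intro!: regular_kpoly kpoly.coord\<close>)
  then have "morphism ?\<Sigma> quot (\<pi> \<circ> id)" by (rule morphism_compose[OF _ morphism_orbit])
  then have 2: "morphism ?\<Sigma> (open_subspace quot (\<pi> ` HS S)) \<pi>"
    by (intro morphism_into_open_subspace openin_quot_chart[OF S])
      (use sec_in[OF S] im_sec[OF S] in auto)
  show ?thesis unfolding isomorphic_def
  proof (intro exI conjI ballI, rule 1, rule 2)
    fix y assume "y \<in> points (open_subspace quot (\<pi> ` HS S))"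
    then obtain x where "x \<in> HS S" "y = \<pi> x"
      using points_open_subspace[OF openin_quot_chart[OF S]] by blast
    then show "\<pi> ((sec S \<circ> pt) y) = y"
      using orbit_eq_iff im_sec[OF S] sec_in[OF S] by (simp add: pt_orbit)
  next
    fix y assume "y \<in> points ?\<Sigma>"
    then show "(sec S \<circ> pt) (\<pi> y) = y"
      using im_sec[OF S] sec_in[OF S] by (auto simp: pt_orbit)
  qed
qed

lemma prevariety_quot: "prevariety quot"
  unfolding prevariety_def
proof (intro exI[of _ "(\<lambda>S. \<pi> ` HS S) ` \<S>"] conjI ballI)
  show "finite ((\<lambda>S. \<pi> ` HS S) ` \<S>)" using finite_charts by simp
  have "\<exists>S\<in>\<S>. \<pi> x \<in> \<pi> ` HS S" if "x \<in> E" for x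
    using cover[OF that] that by blast
  then show "\<Union> ((\<lambda>S. \<pi> ` HS S) ` \<S>) = points quot"
    by (auto simp: Group_Action.orbits_def)
next
  fix U assume "U \<in> (\<lambda>S. \<pi> ` HS S) ` \<S>"
  then obtain S where S: "S \<in> \<S>" "U = \<pi> ` HS S" by blast
  then show "openin (zariski quot) U" using openin_quot_chart by blast
  show "\<exists>n F. F \<subseteq> kpoly (affine_coords n) \<and> isomorphic (open_subspace quot U) (affine_variety n F)"
    using affine_slice[OF S(1)] isomorphic_trans[OF isomorphic_quot_chart[OF S(1)]]
    unfolding S(2) by blast
qed

lemma geometric_quotient_quot: "geometric_quotient G act H quot \<pi>"
  unfolding geometric_quotient_def
proof (intro conjI allI impI ballI)
  show "prevariety quot" by (rule prevariety_quot)
  show "morphism H quot \<pi>" by (rule morphism_orbit)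
next
  fix g x assume g: "g \<in> carrier G" and "x \<in> points H"
  then have x: "x \<in> E" by simp
  have "act g x \<in> \<pi> x" using g by (auto simp: Group_Action.orbit_def)
  then show "\<pi> (act g x) = \<pi> x" using orbit_eq_iff act_closed[OF g x] x orbit_eq by simp
next
  show "\<pi> ` points H = points quot" by (auto simp: Group_Action.orbits_def)
next
  fix x x' assume "x \<in> points H" "x' \<in> points H" "\<pi> x = \<pi> x'"
  then show "x' \<in> \<pi> x" using orbit_eq by simp
next
  fix V assume "V \<subseteq> points quot" "openin (zariski H) {x \<in> points H. \<pi> x \<in> V}"
  then show "openin (zariski quot) V" unfolding openin_orbit_space by simp
next
  fix V h
  assume V: "openin (zariski quot) V" and h: "h \<in> regular H {x \<in> points H. \<pi> x \<in> V}"
    and inv: "\<forall>g\<in>carrier G. \<forall>x\<in>points H. \<pi> x \<in> V \<longrightarrow> h (act g x) = h x"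
  \<comment> \<open>The value at an arbitrary representative; invariance makes it independent of the
    choice on the orbits in \<open>V\<close>.\<close>
  define h' where "h' = (\<lambda>y. h (SOME x. x \<in> y))"
  have eq: "h x = h' (\<pi> x)" if x: "x \<in> E" "\<pi> x \<in> V" for x
  proof -
    have "(SOME z. z \<in> \<pi> x) \<in> \<pi> x"
      using someI[of "\<lambda>z. z \<in> \<pi> x" x] orbit_eq x(1) by simp
    then obtain g where "g \<in> carrier G" "(SOME z. z \<in> \<pi> x) = act g x"
      unfolding Group_Action.orbit_def by blast
    then show ?thesis using inv x by (simp add: h'_def)
  qed
  have "h' \<in> regular quot V"
    unfolding regular_orbit_space by (rule regular_cong[OF h]) (simp add: eq)
  then show "\<exists>h'\<in>regular quot V. \<forall>x\<in>points H. \<pi> x \<in> V \<longrightarrow> h x = h' (\<pi> x)"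
    using eq by (intro bexI[of _ h']) simp_all
qed

text \<open>The sets \<open>HS S\<close> are open and cover \<open>E\<close>, and on each of them
  \<open>im\<close> is a morphism into one embedded piece. Openness of preimages and regularity of
  pullbacks are checked there and then assembled.\<close>

lemma morphism_im: "morphism H gr im"
proof -
  have pre: "openin (zariski H) {x \<in> HS S. im x \<in> W \<inter> D S}"
    and pre_reg: "h \<in> regular gr W \<Longrightarrow> h \<circ> im \<in> regular H {x \<in> HS S. im x \<in> W \<inter> D S}"
    if W: "openin (zariski gr) W" and S: "S \<in> \<S>" for W S h
  proof -
    have o: "openin (zariski (embedded_space (D S) (CC S))) (W \<inter> D S)"
      using W S unfolding openin_glued_space by auto
    note pH = points_open_subspace[OF open_chart[OF S]]
    have "openin (zariski (open_subspace H (HS S))) {x \<in> HS S. im x \<in> W \<inter> D S}"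
      using morphism_openin[OF morphism_im_chart[OF S] o] unfolding pH .
    then show "openin (zariski H) {x \<in> HS S. im x \<in> W \<inter> D S}"
      using open_chart[OF S] by (simp add: openin_open_subtopology)
    assume "h \<in> regular gr W"
    then have "h \<in> regular (embedded_space (D S) (CC S)) (W \<inter> D S)"
      using S unfolding regular_glued_space by auto
    then show "h \<circ> im \<in> regular H {x \<in> HS S. im x \<in> W \<inter> D S}"
      using morphism_regular[OF morphism_im_chart[OF S] o, of h]
      unfolding pH regular_open_subspace by blast
  qed
  show ?thesis unfolding morphism_def continuous_map_def
  proof (intro conjI allI impI ballI)
    show "im \<in> points H \<rightarrow> points gr" using cover by (auto simp: points_glued_space)
  next
    fix W assume W: "openin (zariski gr) W"
    have "{x \<in> points H. im x \<in> W} = (\<Union>S\<in>\<S>. {x \<in> HS S. im x \<in> W \<inter> D S})"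
      using cover by auto
    then show "openin (zariski H) {x \<in> points H. im x \<in> W}"
      using pre[OF W] by (simp only:) (rule openin_Union, blast)
  next
    fix W h assume W: "openin (zariski gr) W" and h: "h \<in> regular gr W"
    show "h \<circ> im \<in> regular H {x \<in> points H. im x \<in> W}"
    proof (rule regular_local)
      fix x assume x: "x \<in> {x \<in> points H. im x \<in> W}"
      then obtain S where S: "S \<in> \<S>" "im x \<in> D S" using cover by auto
      show "\<exists>W'. x \<in> W' \<and> W' \<subseteq> {x \<in> points H. im x \<in> W} \<and> h \<circ> im \<in> regular H W'"
        using pre_reg[OF W S(1) h] x S(2)
        by (intro exI[of _ "{x \<in> HS S. im x \<in> W \<inter> D S}"]) auto
    qed
  qed
qed

text \<open>The map sending \<open>N\<close> to its fibre is globally defined, and on the chart of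
  \<open>S\<close> it equals \<open>\<pi> \<circ> sec S\<close>; so the sections need not be
  compared on overlaps. Its inverse \<open>pt\<close> is a morphism because upstairs it is
  \<open>im\<close>.\<close>

lemma isomorphic_gr_quot: "isomorphic gr quot"
proof -
  let ?\<Phi> = "\<lambda>N. {y \<in> E. im y = N}"
  have 1: "morphism gr quot ?\<Phi>"
  proof (rule morphism_from_glued_space)
    fix D' C' assume "(D', C') \<in> (\<lambda>S. (D S, CC S)) ` \<S>"
    then obtain S where S: "S \<in> \<S>" "D' = D S" "C' = CC S" by blast
    have "morphism (embedded_space (D S) (CC S)) quot (\<pi> \<circ> sec S)"
      by (rule morphism_compose[OF morphism_sec[OF S(1)] morphism_orbit])
    then show "morphism (embedded_space D' C') quot ?\<Phi>"
      unfolding S(2,3) by (rule morphism_cong) (simp add: orbit_eq sec_in im_sec S(1))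
  qed
  have "morphism H gr (pt \<circ> \<pi>)"
    by (rule morphism_cong[OF morphism_im]) (simp add: pt_orbit)
  moreover have "{x \<in> points H. \<pi> x \<in> points quot} = points H"
    by (auto simp: Group_Action.orbits_def)
  ultimately have "morphism (open_subspace H {x \<in> points H. \<pi> x \<in> points quot}) gr (pt \<circ> \<pi>)"
    by (simp only: open_subspace_points)
  then have 2: "morphism quot gr pt"
    using morphism_from_orbit_space[OF openin_topspace] by (simp only: open_subspace_points)
  show ?thesis unfolding isomorphic_def
  proof (intro exI conjI ballI, rule 1, rule 2)
    fix N assume "N \<in> points gr"
    then obtain S where S: "S \<in> \<S>" "N \<in> D S" by (auto simp: points_glued_space)
    then have "?\<Phi> N = \<pi> (sec S N)" by (simp add: orbit_eq sec_in im_sec)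
    then show "pt (?\<Phi> N) = N" using S by (simp add: pt_orbit sec_in im_sec)
  next
    fix y assume "y \<in> points quot"
    then obtain x where x: "x \<in> E" "y = \<pi> x" by (auto simp: Group_Action.orbits_def)
    then have "pt y = im x" by (simp add: pt_orbit)
    then show "?\<Phi> (pt y) = y" using x by (simp add: orbit_eq)
  qed
qed

end

subsection \<open>Row selection and images of matrices\<close>

definition select_rows :: "nat set \<Rightarrow> 'f mat \<Rightarrow> 'f mat"
  where "select_rows S A = mat (card S) (dim_col A) (\<lambda>(r, c). A $$ (sorted_list_of_set S ! r, c))"

definition mat_image :: "'f :: semiring_0 mat \<Rightarrow> 'f vec set"
  where "mat_image A = (\<lambda>v. A *\<^sub>v v) ` carrier_vec (dim_col A)"

text \<open>The columns of \<open>frame n S W\<close> are the basis of \<open>W\<close> that gives the chart coordinates for \<open>S\<close>.\<close>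

definition frame :: "nat \<Rightarrow> nat set \<Rightarrow> 'f :: zero_neq_one vec set \<Rightarrow> 'f mat"
  where "frame n S W = mat n (card S) (\<lambda>(r, c).
    (THE v. v \<in> W \<and> (\<forall>t\<in>S. v $ t = (if t = sorted_list_of_set S ! c then 1 else 0))) $ r)"

text \<open>For a subspace \<open>W\<close> of K^n: it is a complement of the coordinate subspace of
  vectors vanishing on \<open>S\<close>. This is the condition of \<open>chart_domain\<close> at a
  single vertex.\<close>

definition complemented :: "nat \<Rightarrow> nat set \<Rightarrow> 'f vec set \<Rightarrow> bool"
  where "complemented n S W \<longleftrightarrow> (\<forall>w\<in>carrier_vec n. \<exists>!v. v \<in> W \<and> (\<forall>t\<in>S. v $ t = w $ t))"

text \<open>The inverse is given by Cramer's formula so that its entries are visibly polynomials in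
  the entries of \<open>A\<close> divided by the determinant, hence regular functions.\<close>

definition inverse_mat :: "'f :: field mat \<Rightarrow> 'f mat"
  where "inverse_mat A = (1 / det A) \<cdot>\<^sub>m adj_mat A"

lemma inverse_mat:
  assumes "A \<in> carrier_mat n n" "det A \<noteq> 0"
  shows "inverse_mat A \<in> carrier_mat n n" "A * inverse_mat A = 1\<^sub>m n" "inverse_mat A * A = 1\<^sub>m n"
proof -
  note adj = adj_mat[OF assms(1)]
  show "inverse_mat A \<in> carrier_mat n n" using adj(1) by (simp add: inverse_mat_def)
  have *: "(1 / det A) \<cdot>\<^sub>m (det A \<cdot>\<^sub>m 1\<^sub>m n) = 1\<^sub>m n"
    using assms(2) by (intro eq_matI) auto
  show "A * inverse_mat A = 1\<^sub>m n"
    unfolding inverse_mat_def mult_smult_distrib[OF assms(1) adj(1)] adj(2) * ..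
  show "inverse_mat A * A = 1\<^sub>m n"
    unfolding inverse_mat_def mult_smult_assoc_mat[OF adj(1) assms(1)] adj(3) * ..
qed

lemma mult_unit_vec:
  fixes A :: "'f :: semiring_1 mat"
  assumes "A \<in> carrier_mat n k" "j < k"
  shows "A *\<^sub>v unit_vec k j = col A j"
  using assms by (intro eq_vecI) auto

lemma nth_sorted_list_of_set_in: "finite S \<Longrightarrow> r < card S \<Longrightarrow> sorted_list_of_set S ! r \<in> S"
  by (metis nth_mem set_sorted_list_of_set length_sorted_list_of_set)

lemma ex_nth_sorted_list_of_set:
  "finite S \<Longrightarrow> t \<in> S \<Longrightarrow> \<exists>r<card S. sorted_list_of_set S ! r = t"
  by (metis in_set_conv_nth set_sorted_list_of_set length_sorted_list_of_set)

lemma nth_sorted_list_of_set_eq_iff: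
  "r < card S \<Longrightarrow> c < card S \<Longrightarrow> sorted_list_of_set S ! r = sorted_list_of_set S ! c \<longleftrightarrow> r = c"
  by (simp add: nth_eq_iff_index_eq)

lemma select_rows_carrier: "A \<in> carrier_mat n k \<Longrightarrow> select_rows S A \<in> carrier_mat (card S) k"
  by (simp add: select_rows_def)

lemma index_select_rows:
  "r < card S \<Longrightarrow> c < dim_col A \<Longrightarrow> select_rows S A $$ (r, c) = A $$ (sorted_list_of_set S ! r, c)"
  by (simp add: select_rows_def)

lemma dim_select_rows [simp]:
  "dim_row (select_rows S A) = card S" "dim_col (select_rows S A) = dim_col A"
  by (simp_all add: select_rows_def)

lemma row_select_rows:
  assumes "S \<subseteq> {..<dim_row A}" "r < card S"
  shows "row (select_rows S A) r = row A (sorted_list_of_set S ! r)"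
proof -
  have "sorted_list_of_set S ! r < dim_row A"
    using nth_sorted_list_of_set_in[of S r] assms finite_subset by blast
  then show ?thesis using assms by (intro eq_vecI) (simp_all add: select_rows_def)
qed

lemma select_rows_mult:
  assumes "S \<subseteq> {..<dim_row A}"
  shows "select_rows S (A * B) = select_rows S A * B"
proof (rule eq_matI)
  fix r c assume "r < dim_row (select_rows S A * B)" "c < dim_col (select_rows S A * B)"
  then have rc: "r < card S" "c < dim_col B" by simp_all
  then have "sorted_list_of_set S ! r < dim_row A"
    using nth_sorted_list_of_set_in[of S r] assms finite_subset by blast
  then show "select_rows S (A * B) $$ (r, c) = (select_rows S A * B) $$ (r, c)"
    using rc assms by (simp add: index_select_rows row_select_rows)
qed simp_all

lemma index_select_rows_mult_vec:
  fixes A :: "'f :: semiring_0 mat"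
  assumes "S \<subseteq> {..<dim_row A}" "r < card S"
  shows "(select_rows S A *\<^sub>v v) $ r = (A *\<^sub>v v) $ (sorted_list_of_set S ! r)"
proof -
  have "sorted_list_of_set S ! r < dim_row A"
    using nth_sorted_list_of_set_in[of S r] assms finite_subset by blast
  then show ?thesis using assms by (simp add: row_select_rows)
qed

text \<open>Bridge between two descriptions of rows: charts compare entries at the elements of
  \<open>S\<close>, matrices at positions in the sorted enumeration of \<open>S\<close>.\<close>

lemma agree_on_iff_select_rows:
  fixes A :: "'f :: semiring_0 mat" and w :: "'f vec"
  assumes S: "S \<subseteq> {..<n}" and A: "A \<in> carrier_mat n k"
  shows "(\<forall>t\<in>S. (A *\<^sub>v u) $ t = w $ t) \<longleftrightarrow>
    select_rows S A *\<^sub>v u = vec (card S) (\<lambda>r. w $ (sorted_list_of_set S ! r))"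
proof -
  have fin: "finite S" using S finite_subset by blast
  have SA: "S \<subseteq> {..<dim_row A}" using S A by simp
  have "(\<forall>t\<in>S. (A *\<^sub>v u) $ t = w $ t) \<longleftrightarrow>
      (\<forall>r<card S. (A *\<^sub>v u) $ (sorted_list_of_set S ! r) = w $ (sorted_list_of_set S ! r))"
    using nth_sorted_list_of_set_in[OF fin] ex_nth_sorted_list_of_set[OF fin] by metis
  also have "\<dots> \<longleftrightarrow> (\<forall>r<card S. (select_rows S A *\<^sub>v u) $ r = w $ (sorted_list_of_set S ! r))"
    using index_select_rows_mult_vec[OF SA] by metis
  also have "\<dots> \<longleftrightarrow> select_rows S A *\<^sub>v u = vec (card S) (\<lambda>r. w $ (sorted_list_of_set S ! r))"
    by (auto simp: vec_eq_iff)
  finally show ?thesis .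
qed

section \<open>Images of matrices and their normalized frames\<close>

lemma mat_image_mult_invertible:
  fixes A :: "'f :: field mat"
  assumes A: "A \<in> carrier_mat n k" and P: "P \<in> carrier_mat k k" "P' \<in> carrier_mat k k" "P * P' = 1\<^sub>m k"
  shows "mat_image (A * P) = mat_image A"
proof
  show "mat_image (A * P) \<subseteq> mat_image A"
    using A P by (auto simp: mat_image_def intro!: image_eqI)
  have "A *\<^sub>v v = (A * P) *\<^sub>v (P' *\<^sub>v v)" if v: "v \<in> carrier_vec k" for v
  proof -
    have "(A * P) *\<^sub>v (P' *\<^sub>v v) = A *\<^sub>v (P *\<^sub>v (P' *\<^sub>v v))"
      using A P(1,2) v by (intro assoc_mult_mat_vec) auto
    also have "P *\<^sub>v (P' *\<^sub>v v) = (P * P') *\<^sub>v v"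
      using P(1,2) v by (intro assoc_mult_mat_vec[symmetric])
    also have "\<dots> = v" unfolding P(3) using v by simp
    finally show ?thesis ..
  qed
  then show "mat_image A \<subseteq> mat_image (A * P)"
    using A P by (auto simp: mat_image_def intro!: image_eqI[where x = "P' *\<^sub>v _"])
qed

text \<open>With identity rows at \<open>S\<close>, the entries of F u at \<open>S\<close> are the
  coordinates of u. So prescribed entries on \<open>S\<close> determine exactly one vector of the
  image, and prescribing a unit vector yields a column of \<open>F\<close>, which is what
  \<open>frame\<close> selects.\<close>

lemma mat_image_normalized:
  fixes F :: "'f :: field mat"
  assumes S: "S \<subseteq> {..<n}" and F: "F \<in> carrier_mat n (card S)" and one: "select_rows S F = 1\<^sub>m (card S)"
  shows "complemented n S (mat_image F)" and "frame n S (mat_image F) = F"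
    and "v \<in> mat_image F \<Longrightarrow> F *\<^sub>v vec (card S) (\<lambda>r. v $ (sorted_list_of_set S ! r)) = v"
proof -
  have fin: "finite S" using S finite_subset by blast
  define sel where "sel = (\<lambda>w :: 'f vec. vec (card S) (\<lambda>r. w $ (sorted_list_of_set S ! r)))"
  have agree: "(\<forall>t\<in>S. (F *\<^sub>v u) $ t = w $ t) \<longleftrightarrow> u = sel w" if "u \<in> carrier_vec (card S)" for u w
    unfolding agree_on_iff_select_rows[OF S F] one sel_def using that by simp
  have sel: "sel w \<in> carrier_vec (card S)" for w by (simp add: sel_def)
  have mem: "v \<in> mat_image F \<longleftrightarrow> (\<exists>u\<in>carrier_vec (card S). v = F *\<^sub>v u)" for v
    using F by (auto simp: mat_image_def)
  have ex1: "v \<in> mat_image F \<and> (\<forall>t\<in>S. v $ t = w $ t) \<longleftrightarrow> v = F *\<^sub>v sel w" for v w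
  proof
    assume v: "v \<in> mat_image F \<and> (\<forall>t\<in>S. v $ t = w $ t)"
    then obtain u where u: "u \<in> carrier_vec (card S)" "v = F *\<^sub>v u" unfolding mem by blast
    then show "v = F *\<^sub>v sel w" using agree[OF u(1), of w] v by simp
  next
    assume "v = F *\<^sub>v sel w"
    then show "v \<in> mat_image F \<and> (\<forall>t\<in>S. v $ t = w $ t)"
      unfolding mem using agree[OF sel, of w w] sel by blast
  qed
  show "complemented n S (mat_image F)" unfolding complemented_def ex1 by blast
  show "F *\<^sub>v vec (card S) (\<lambda>r. v $ (sorted_list_of_set S ! r)) = v" if "v \<in> mat_image F"
    using ex1[of v v] that by (simp add: sel_def)
  show "frame n S (mat_image F) = F"
  proof (rule eq_matI)
    fix r c assume "r < dim_row F" "c < dim_col F"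
    then have rc: "r < n" "c < card S" using F by simp_all
    let ?s = "sorted_list_of_set S ! c"
    let ?w = "vec n (\<lambda>t. if t = ?s then 1 else 0) :: 'f vec"
    \<comment> \<open>The condition in \<open>frame\<close> concerns entries in \<open>S\<close>
      only, where the Kronecker delta agrees with the vector \<open>?w\<close>.\<close>
    have "(v \<in> mat_image F \<and> (\<forall>t\<in>S. v $ t = (if t = ?s then 1 else 0))) \<longleftrightarrow> v = F *\<^sub>v sel ?w" for v
      unfolding ex1[symmetric] using S by (intro conj_cong refl ball_cong) (auto simp: subset_iff)
    then have "frame n S (mat_image F) $$ (r, c) = (F *\<^sub>v sel ?w) $ r"
      using rc by (simp add: frame_def)
    also have "sel ?w = unit_vec (card S) c"
    proof (rule eq_vecI)
      fix q assume "q < dim_vec (unit_vec (card S) c)"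
      then have q: "q < card S" by simp
      then have "sorted_list_of_set S ! q < n" using nth_sorted_list_of_set_in[OF fin q] S by blast
      then show "sel ?w $ q = unit_vec (card S) c $ q"
        using q rc(2) by (simp add: sel_def nth_sorted_list_of_set_eq_iff)
    qed (simp add: sel_def)
    also have "(F *\<^sub>v unit_vec (card S) c) $ r = F $$ (r, c)"
      using rc F by simp
    finally show "frame n S (mat_image F) $$ (r, c) = F $$ (r, c)" .
  qed (use F in \<open>simp_all add: frame_def\<close>)
qed

text \<open>Right multiplication by the inverse of the square block preserves the image and turns
  the block into the identity, which reduces to \<open>mat_image_normalized\<close>. The resulting
  formula for the frame is the source of regularity of the chart coordinates.\<close>

lemma normalize_rows:
  fixes f :: "'f :: field mat"
  assumes S: "S \<subseteq> {..<n}" and f: "f \<in> carrier_mat n (card S)" and det: "det (select_rows S f) \<noteq> 0"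
  shows "complemented n S (mat_image f)"
    and "frame n S (mat_image f) = f * inverse_mat (select_rows S f)"
    and "inj_on (\<lambda>v. f *\<^sub>v v) (carrier_vec (card S))"
proof -
  let ?M = "select_rows S f"
  have M: "?M \<in> carrier_mat (card S) (card S)" using f by (rule select_rows_carrier)
  note inv = inverse_mat[OF M det]
  let ?F = "f * inverse_mat ?M"
  have F: "?F \<in> carrier_mat n (card S)" using f inv(1) by simp
  have im: "mat_image ?F = mat_image f" by (rule mat_image_mult_invertible[OF f inv(1) M inv(3)])
  have "select_rows S ?F = 1\<^sub>m (card S)" using select_rows_mult[of S f] S f inv(2) by simp
  from mat_image_normalized(1,2)[OF S F this]
  show "complemented n S (mat_image f)" "frame n S (mat_image f) = ?F" unfolding im .
  show "inj_on (\<lambda>v. f *\<^sub>v v) (carrier_vec (card S))"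
  proof (rule inj_onI)
    fix u v assume u: "u \<in> carrier_vec (card S)" and v: "v \<in> carrier_vec (card S)"
      and eq: "f *\<^sub>v u = f *\<^sub>v v"
    have "\<forall>t\<in>S. (f *\<^sub>v u) $ t = (f *\<^sub>v v) $ t" using eq by simp
    moreover have "\<forall>t\<in>S. (f *\<^sub>v v) $ t = (f *\<^sub>v v) $ t" by simp
    ultimately have "?M *\<^sub>v u = ?M *\<^sub>v v" unfolding agree_on_iff_select_rows[OF S f] by metis
    then have "(inverse_mat ?M * ?M) *\<^sub>v u = (inverse_mat ?M * ?M) *\<^sub>v v"
      using assoc_mult_mat_vec[OF inv(1) M] u v by metis
    then show "u = v" unfolding inv(3) using u v by simp
  qed
qed

text \<open>A kernel vector u of the square block gives f u in the image vanishing on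
  \<open>S\<close>. Since 0 is also such a vector, uniqueness forces f u = 0, against
  injectivity.\<close>

lemma det_nonzero_if_complemented:
  fixes f :: "'f :: field mat"
  assumes S: "S \<subseteq> {..<n}" and f: "f \<in> carrier_mat n (card S)"
    and inj: "inj_on (\<lambda>v. f *\<^sub>v v) (carrier_vec (card S))"
    and compl: "complemented n S (mat_image f)"
  shows "det (select_rows S f) \<noteq> 0"
proof
  assume "det (select_rows S f) = 0"
  then obtain u where u: "u \<in> carrier_vec (card S)" "u \<noteq> 0\<^sub>v (card S)"
    "select_rows S f *\<^sub>v u = 0\<^sub>v (card S)"
    using det_0_iff_vec_prod_zero_field[OF select_rows_carrier[OF f]] by blast
  have fin: "finite S" using S finite_subset by blast
  have "vec (card S) (\<lambda>r. (0\<^sub>v n :: 'f vec) $ (sorted_list_of_set S ! r)) = 0\<^sub>v (card S)"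
    using nth_sorted_list_of_set_in[OF fin] S by (intro eq_vecI) (simp_all add: subset_iff)
  then have "\<forall>t\<in>S. (f *\<^sub>v u) $ t = (0\<^sub>v n) $ t"
    unfolding agree_on_iff_select_rows[OF S f] using u(3) by simp
  moreover have "f *\<^sub>v u \<in> mat_image f" using u(1) f by (auto simp: mat_image_def)
  moreover have z: "f *\<^sub>v 0\<^sub>v (card S) = 0\<^sub>v n" using f by (intro eq_vecI) auto
  then have "0\<^sub>v n \<in> mat_image f"
    using f unfolding mat_image_def by (intro image_eqI[of _ _ "0\<^sub>v (card S)"]) auto
  moreover have "\<exists>!v. v \<in> mat_image f \<and> (\<forall>t\<in>S. v $ t = (0\<^sub>v n) $ t)"
    using compl by (simp add: complemented_def)
  ultimately have "f *\<^sub>v u = 0\<^sub>v n" by blast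
  then show False using inj u(1,2) z by (metis inj_onD zero_carrier_vec)
qed

text \<open>Lying in the chart of \<open>S\<close> depends only on the image, so the block M' of
  \<open>f'\<close> is invertible like the block M of \<open>f\<close>. Equal images have equal
  frames, so f times the inverse of M equals f' times the inverse of M'; solving for f' gives
  \<open>h\<close> as the inverse of M times M'.\<close>

lemma same_image_normalized:
  fixes f f' :: "'f :: field mat"
  assumes S: "S \<subseteq> {..<n}" and f: "f \<in> carrier_mat n (card S)" "f' \<in> carrier_mat n (card S)"
    and inj: "inj_on (\<lambda>v. f' *\<^sub>v v) (carrier_vec (card S))"
    and det: "det (select_rows S f) \<noteq> 0" and im: "mat_image f' = mat_image f"
  obtains g h where "g \<in> carrier_mat (card S) (card S)" "h \<in> carrier_mat (card S) (card S)"
    "g * h = 1\<^sub>m (card S)" "h * g = 1\<^sub>m (card S)" "f' = f * h"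
proof -
  let ?k = "card S" and ?M = "select_rows S f" and ?M' = "select_rows S f'"
  have det': "det ?M' \<noteq> 0"
    using det_nonzero_if_complemented[OF S f(2) inj] normalize_rows(1)[OF S f(1) det] im by simp
  have M: "?M \<in> carrier_mat ?k ?k" "?M' \<in> carrier_mat ?k ?k" using f by (simp_all add: select_rows_carrier)
  note i = inverse_mat[OF M(1) det] and i' = inverse_mat[OF M(2) det']
  have F: "f * inverse_mat ?M = f' * inverse_mat ?M'"
    using normalize_rows(2)[OF S f(1) det] normalize_rows(2)[OF S f(2) det'] im by simp
  have gh: "(inverse_mat A * B) * (inverse_mat B * A) = 1\<^sub>m ?k"
    if "A \<in> carrier_mat ?k ?k" "B \<in> carrier_mat ?k ?k" "det A \<noteq> 0" "det B \<noteq> 0" for A B :: "'f mat"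
  proof -
    note iA = inverse_mat[OF that(1,3)] and iB = inverse_mat[OF that(2,4)]
    have "(inverse_mat A * B) * (inverse_mat B * A) = inverse_mat A * (B * inverse_mat B * A)"
      using that iA(1) iB(1) by (simp add: assoc_mult_mat[of _ ?k ?k _ ?k _ ?k])
    then show ?thesis using that(1) iA iB by simp
  qed
  have "f * (inverse_mat ?M * ?M') = (f * inverse_mat ?M) * ?M'"
    using f M i(1) by (simp add: assoc_mult_mat[of _ n ?k _ ?k _ ?k])
  also have "\<dots> = f' * (inverse_mat ?M' * ?M')"
    unfolding F using f M i'(1) by (simp add: assoc_mult_mat[of _ n ?k _ ?k _ ?k])
  also have "\<dots> = f'" using i'(3) f(2) by simp
  finally have "f' = f * (inverse_mat ?M * ?M')" ..
  then show thesis
    using that[of "inverse_mat ?M' * ?M" "inverse_mat ?M * ?M'"] gh M det det' i(1) i'(1) by simp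
qed

section \<open>Subspaces as images of matrices\<close>

lemma mult_mat_vec_in_subspace:
  fixes F :: "'f :: field mat"
  assumes W: "VectorSpace.subspace class_ring W (module_vec TYPE('f) n)"
    and F: "F \<in> carrier_mat n k" and cols: "\<And>c. c < k \<Longrightarrow> col F c \<in> W" and v: "v \<in> carrier_vec k"
  shows "F *\<^sub>v v \<in> W"
proof -
  have sub: "submodule class_ring W (module_vec TYPE('f) n)"
    using W by (simp add: VectorSpace.subspace_def)
  have zero: "0\<^sub>v n \<in> W" and add: "\<And>x y. x \<in> W \<Longrightarrow> y \<in> W \<Longrightarrow> x + y \<in> W"
    and smult: "\<And>c x. x \<in> W \<Longrightarrow> c \<cdot>\<^sub>v x \<in> W"
    using submodule.zero_closed[OF sub] submodule.m_closed[OF sub] submodule.smult_closed[OF sub]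
    by (simp_all add: module_vec_simps)
  \<comment> \<open>The product is a linear combination of the columns, built up one column at a
    time inside \<open>W\<close>.\<close>
  have "j \<le> k \<Longrightarrow> vec n (\<lambda>r. \<Sum>c<j. F $$ (r, c) * v $ c) \<in> W" for j
  proof (induction j)
    case 0
    have "vec n (\<lambda>r. \<Sum>c<0. F $$ (r, c) * v $ c) = 0\<^sub>v n" by auto
    then show ?case using zero by simp
  next
    case (Suc j)
    have "vec n (\<lambda>r. \<Sum>c<Suc j. F $$ (r, c) * v $ c) =
        vec n (\<lambda>r. \<Sum>c<j. F $$ (r, c) * v $ c) + v $ j \<cdot>\<^sub>v col F j"
      using F Suc.prems by (intro eq_vecI) (auto simp: mult.commute)
    then show ?case using Suc add smult cols by simp
  qed
  from this[of k] have "vec n (\<lambda>r. \<Sum>c<k. F $$ (r, c) * v $ c) \<in> W" by simp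
  moreover have "vec n (\<lambda>r. \<Sum>c<k. F $$ (r, c) * v $ c) = F *\<^sub>v v"
    using F v by (intro eq_vecI) (auto simp: scalar_prod_def atLeast0LessThan)
  ultimately show ?thesis by simp
qed

text \<open>Here the subspace comes first: \<open>complemented\<close> makes the columns of the
  frame well-defined elements of \<open>W\<close>, so their span lies in \<open>W\<close>.
  Conversely a vector of \<open>W\<close> agrees on \<open>S\<close> with some vector of the span,
  and uniqueness inside \<open>W\<close> identifies the two.\<close>

lemma frame_of_subspace:
  fixes W :: "'f :: field vec set"
  assumes S: "S \<subseteq> {..<n}" and W: "VectorSpace.subspace class_ring W (module_vec TYPE('f) n)"
    and compl: "complemented n S W"
  shows "select_rows S (frame n S W) = 1\<^sub>m (card S)" and "mat_image (frame n S W) = W"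
proof -
  let ?F = "frame n S W"
  have fin: "finite S" using S finite_subset by blast
  have F: "?F \<in> carrier_mat n (card S)" by (simp add: frame_def)
  have WV: "W \<subseteq> carrier_vec n"
    using submodule.subset[of class_ring W "module_vec TYPE('f) n"] W
    by (simp add: VectorSpace.subspace_def module_vec_simps)
  have col: "col ?F c \<in> W \<and> (\<forall>t\<in>S. col ?F c $ t = (if t = sorted_list_of_set S ! c then 1 else 0))"
    if c: "c < card S" for c
  proof -
    let ?P = "\<lambda>v. v \<in> W \<and> (\<forall>t\<in>S. v $ t = (if t = sorted_list_of_set S ! c then 1 else 0))"
    let ?w = "vec n (\<lambda>t. if t = sorted_list_of_set S ! c then 1 else 0) :: 'f vec"
    have "(\<forall>t\<in>S. v $ t = ?w $ t) \<longleftrightarrow>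
        (\<forall>t\<in>S. v $ t = (if t = sorted_list_of_set S ! c then 1 else 0))" for v :: "'f vec"
      using S by (intro ball_cong refl) (auto simp: subset_iff)
    moreover have "\<exists>!v. v \<in> W \<and> (\<forall>t\<in>S. v $ t = ?w $ t)" using compl by (simp add: complemented_def)
    ultimately have "\<exists>!v. ?P v" by simp
    then have P: "?P (THE v. ?P v)" by (rule theI')
    moreover have "col ?F c = (THE v. ?P v)"
    proof (rule eq_vecI)
      have "(THE v. ?P v) \<in> carrier_vec n" using P WV by blast
      then show "dim_vec (col ?F c) = dim_vec (THE v. ?P v)" by (simp add: frame_def)
      then show "col ?F c $ r = (THE v. ?P v) $ r" if "r < dim_vec (THE v. ?P v)" for r
        using that c by (simp add: frame_def)
    qed
    ultimately show ?thesis by metis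
  qed
  show one: "select_rows S ?F = 1\<^sub>m (card S)"
  proof (rule eq_matI)
    fix r c assume "r < dim_row (1\<^sub>m (card S))" "c < dim_col (1\<^sub>m (card S))"
    then have rc: "r < card S" "c < card S" by simp_all
    have s: "sorted_list_of_set S ! r \<in> S" by (rule nth_sorted_list_of_set_in[OF fin rc(1)])
    then have "sorted_list_of_set S ! r < n" using S by blast
    then have "select_rows S ?F $$ (r, c) = col ?F c $ (sorted_list_of_set S ! r)"
      using rc F by (simp add: index_select_rows)
    then show "select_rows S ?F $$ (r, c) = 1\<^sub>m (card S) $$ (r, c)"
      using col[OF rc(2)] s rc by (simp add: nth_sorted_list_of_set_eq_iff)
  qed (use F in simp_all)
  have sub: "mat_image ?F \<subseteq> W"
    using mult_mat_vec_in_subspace[OF W F] col F by (auto simp: mat_image_def)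
  moreover have "v \<in> mat_image ?F" if v: "v \<in> W" for v
  proof -
    have "v \<in> carrier_vec n" using v WV by blast
    then obtain u :: "'f vec" where "u \<in> mat_image ?F" "\<forall>t\<in>S. u $ t = v $ t"
      using mat_image_normalized(1)[OF S F one] unfolding complemented_def by blast
    moreover have "\<exists>!u. u \<in> W \<and> (\<forall>t\<in>S. u $ t = v $ t)"
      using compl \<open>v \<in> carrier_vec n\<close> unfolding complemented_def by blast
    ultimately have "u = v" using sub v by blast
    then show ?thesis using \<open>u \<in> mat_image ?F\<close> by simp
  qed
  ultimately show "mat_image ?F = W" by blast
qed

lemma mat_image_in_subspaces:
  fixes f :: "'f :: field mat"
  assumes f: "f \<in> carrier_mat n d" and inj: "inj_on (\<lambda>v. f *\<^sub>v v) (carrier_vec d)"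
  shows "mat_image f \<in> subspaces n d"
proof -
  interpret vec_space "TYPE('f)" n .
  have z: "f *\<^sub>v 0\<^sub>v d = 0\<^sub>v n" using f by (intro eq_vecI) auto
  have span: "mat_image f = span (set (cols f))"
    using col_space_eq[OF f] f unfolding col_space_def mat_image_def by auto
  have cols: "set (cols f) \<subseteq> carrier_vec n" using f cols_dim by blast
  \<comment> \<open>Columns enter the span as a set, so repetitions must be excluded before
    independence can give the dimension. Injectivity on unit vectors excludes them.\<close>
  have dist: "distinct (cols f)"
    unfolding distinct_conv_nth
  proof (intro allI impI)
    fix i j assume "i < length (cols f)" "j < length (cols f)" and ij: "i \<noteq> j"
    then have i: "i < d" and j: "j < d" using f by simp_all
    show "cols f ! i \<noteq> cols f ! j"
    proof
      assume "cols f ! i = cols f ! j"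
      then have "f *\<^sub>v unit_vec d i = f *\<^sub>v unit_vec d j"
        using i j f by (simp add: mult_unit_vec)
      then have "unit_vec d i = (unit_vec d j :: 'f vec)"
        using inj by (auto dest!: inj_onD)
      then show False using ij i j by (metis index_unit_vec(1) zero_neq_one)
    qed
  qed
  have "lin_indpt (set (cols f))"
  proof
    assume "lin_dep (set (cols f))"
    then obtain v where "v \<in> carrier_vec d" "v \<noteq> 0\<^sub>v d" "f *\<^sub>v v = 0\<^sub>v n"
      using lin_depE[OF f _ dist] by blast
    then show False using inj z by (metis inj_onD zero_carrier_vec)
  qed
  then have "rank f = d" using lin_indpt_full_rank f dist by blast
  then have "vectorspace.dim class_ring (module_vec TYPE('f) n\<lparr>carrier := mat_image f\<rparr>) = d"
    unfolding rank_def span .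
  moreover have "VectorSpace.subspace class_ring (mat_image f) (module_vec TYPE('f) n)"
    unfolding span using span_is_subspace[of "set (cols f)"] cols by simp
  ultimately show ?thesis by (simp add: subspaces_def)
qed

section \<open>Kernels and nonzero minors\<close>

lemma wide_mat_kernel:
  fixes A :: "'f :: field mat"
  assumes A: "A \<in> carrier_mat n k" and "n < k"
  obtains v where "v \<in> carrier_vec k" "v \<noteq> 0\<^sub>v k" "A *\<^sub>v v = 0\<^sub>v n"
proof -
  \<comment> \<open>Padding with zero rows makes the matrix square. Row \<open>n\<close> is then
    zero, so the transpose kills the \<open>n\<close>-th unit vector and the determinant
    vanishes.\<close>
  define B where "B = mat k k (\<lambda>(r, c). if r < n then A $$ (r, c) else 0)"
  have B: "B \<in> carrier_mat k k" by (simp add: B_def)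
  have "transpose_mat B *\<^sub>v unit_vec k n = 0\<^sub>v k"
    using assms by (subst mult_unit_vec[of _ k]) (auto simp: B_def)
  moreover have "unit_vec k n \<noteq> (0\<^sub>v k :: 'f vec)"
    using assms(2) by (metis index_unit_vec(1) index_zero_vec(1) zero_neq_one)
  ultimately have "det (transpose_mat B) = 0"
    using det_0_iff_vec_prod_zero_field[of "transpose_mat B" k] B by (metis transpose_carrier_mat unit_vec_carrier)
  then have "det B = 0" using det_transpose[OF B] by simp
  then obtain v where v: "v \<in> carrier_vec k" "v \<noteq> 0\<^sub>v k" "B *\<^sub>v v = 0\<^sub>v k"
    using det_0_iff_vec_prod_zero_field[OF B] by blast
  have "A *\<^sub>v v = 0\<^sub>v n"
  proof (rule eq_vecI)
    fix r assume "r < dim_vec (0\<^sub>v n :: 'f vec)"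
    then have r: "r < n" by simp
    then have "row B r = row A r" using A assms(2) by (intro eq_vecI) (auto simp: B_def)
    then have "(A *\<^sub>v v) $ r = (B *\<^sub>v v) $ r" using r A B assms(2) by simp
    then show "(A *\<^sub>v v) $ r = 0\<^sub>v n $ r" using v(3) r assms(2) by simp
  qed (use A in simp)
  then show thesis using that v by blast
qed

text \<open>
  Among the row sets on which \<open>f\<close> is still injective, a minimal one has exactly \<open>d\<close> elements:
  with more, a linear dependency makes one of the rows redundant.
\<close>

lemma ex_nonzero_minor:
  fixes f :: "'f :: field mat"
  assumes f: "f \<in> carrier_mat n d" and inj: "inj_on (\<lambda>v. f *\<^sub>v v) (carrier_vec d)"
  obtains S where "S \<subseteq> {..<n}" "card S = d" "det (select_rows S f) \<noteq> 0"
proof -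
  define P where "P = (\<lambda>S. S \<subseteq> {..<n} \<and>
    (\<forall>v\<in>carrier_vec d. (\<forall>t\<in>S. (f *\<^sub>v v) $ t = 0) \<longrightarrow> v = 0\<^sub>v d))"
  have z: "f *\<^sub>v 0\<^sub>v d = 0\<^sub>v n" using f by (intro eq_vecI) auto
  have "P {..<n}" unfolding P_def
  proof (intro conjI ballI impI subset_refl)
    fix v assume v: "v \<in> carrier_vec d" "\<forall>t\<in>{..<n}. (f *\<^sub>v v) $ t = 0"
    then have "f *\<^sub>v v = f *\<^sub>v 0\<^sub>v d" unfolding z using f by (intro eq_vecI) auto
    then show "v = 0\<^sub>v d" using inj v(1) by (auto dest: inj_onD)
  qed
  then obtain S where S: "P S" and min: "\<And>T. P T \<Longrightarrow> card S \<le> card T"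
    using ex_has_least_nat[of P _ card] by blast
  have sub: "S \<subseteq> {..<n}" and ker: "\<And>v. v \<in> carrier_vec d \<Longrightarrow> \<forall>t\<in>S. (f *\<^sub>v v) $ t = 0 \<Longrightarrow> v = 0\<^sub>v d"
    using S by (auto simp: P_def)
  have fin: "finite S" using sub finite_subset by blast
  let ?M = "select_rows S f"
  have M: "?M \<in> carrier_mat (card S) d" using f by (rule select_rows_carrier)
  have subf: "S \<subseteq> {..<dim_row f}" using sub f by simp
  have agree: "(\<forall>t\<in>S. (f *\<^sub>v v) $ t = 0)" if "?M *\<^sub>v v = 0\<^sub>v (card S)" for v
  proof
    fix t assume "t \<in> S"
    then obtain r where "r < card S" "sorted_list_of_set S ! r = t"
      using ex_nth_sorted_list_of_set[OF fin] by blast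
    then show "(f *\<^sub>v v) $ t = 0"
      using index_select_rows_mult_vec[OF subf, of r v] that by simp
  qed
  \<comment> \<open>With fewer than \<open>d\<close> rows the selected block would have a nonzero
    kernel vector, so \<open>f\<close> would not be injective on these rows.\<close>
  have "\<not> card S < d" using wide_mat_kernel[OF M] agree ker by metis
  moreover have "\<not> d < card S"
  proof
    assume "d < card S"
    then obtain u where u: "u \<in> carrier_vec (card S)" "u \<noteq> 0\<^sub>v (card S)"
      "transpose_mat ?M *\<^sub>v u = 0\<^sub>v d"
      using wide_mat_kernel[of "transpose_mat ?M" d "card S"] M by auto
    obtain q where q: "q < card S" "u $ q \<noteq> 0"
      using u(1,2) by (metis carrier_vecD eq_vecI index_zero_vec)
    let ?t = "sorted_list_of_set S ! q"
    have t: "?t \<in> S" by (rule nth_sorted_list_of_set_in[OF fin q(1)])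
    have "P (S - {?t})" unfolding P_def
    proof (intro conjI ballI impI)
      fix v assume v: "v \<in> carrier_vec d" and van: "\<forall>s\<in>S - {?t}. (f *\<^sub>v v) $ s = 0"
      \<comment> \<open>As \<open>u\<close> annihilates every column of \<open>?M\<close>, pairing
        it with the product of \<open>?M\<close> and \<open>v\<close> gives 0. All entries of that
        product except the \<open>q\<close>-th vanish, and the \<open>q\<close>-th entry of
        \<open>u\<close> is nonzero, so the remaining entry vanishes too.\<close>
      have "u \<bullet> (?M *\<^sub>v v) = (transpose_mat ?M *\<^sub>v u) \<bullet> v"
        using transpose_vec_mult_scalar[OF M v u(1)] by simp
      then have "u \<bullet> (?M *\<^sub>v v) = 0" using u(3) v by simp
      moreover have "(?M *\<^sub>v v) $ r = 0" if "r < card S" "r \<noteq> q" for r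
      proof -
        have "sorted_list_of_set S ! r \<in> S - {?t}"
          using nth_sorted_list_of_set_in[OF fin that(1)] that q(1)
          by (simp add: nth_sorted_list_of_set_eq_iff)
        then show ?thesis using van index_select_rows_mult_vec[OF subf that(1)] by simp
      qed
      then have "u \<bullet> (?M *\<^sub>v v) = u $ q * (?M *\<^sub>v v) $ q"
        unfolding scalar_prod_def using q(1) M
        by (subst sum.remove[of _ q]) (auto intro!: sum.neutral)
      ultimately have "(?M *\<^sub>v v) $ q = 0" using q(2) by simp
      then have "(f *\<^sub>v v) $ ?t = 0" using index_select_rows_mult_vec[OF subf q(1)] by simp
      then show "v = 0\<^sub>v d" using ker[OF v] van by blast
    qed (use sub in blast)
    from min[OF this] show False using t fin by (metis card_Diff1_less not_less)
  qed
  ultimately have card: "card S = d" by simp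
  have "det ?M \<noteq> 0"
    using det_0_iff_vec_prod_zero_field[of ?M d] M agree ker unfolding card by metis
  then show thesis using that sub card by blast
qed

text \<open>If B = F X with \<open>F\<close> normalized, then reading the rows \<open>S\<close>
  gives X = \<open>select_rows S B\<close>. This determines the arrow maps on a slice by a
  polynomial formula.\<close>

lemma normalized_factor:
  fixes F :: "'f :: field mat"
  assumes S: "S \<subseteq> {..<n}" and F: "F \<in> carrier_mat n (card S)" and one: "select_rows S F = 1\<^sub>m (card S)"
    and B: "B \<in> carrier_mat n k" and cols: "\<And>c. c < k \<Longrightarrow> col B c \<in> mat_image F"
  shows "F * select_rows S B = B"
proof (rule eq_matI)
  fix r c assume "r < dim_row B" "c < dim_col B"
  then have rc: "r < n" "c < k" using B by simp_all
  have fin: "finite S" using S finite_subset by blast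
  have "vec (card S) (\<lambda>q. col B c $ (sorted_list_of_set S ! q)) = col (select_rows S B) c"
  proof (rule eq_vecI)
    fix q assume "q < dim_vec (col (select_rows S B) c)"
    then have q: "q < card S" by simp
    then have "sorted_list_of_set S ! q < n" using nth_sorted_list_of_set_in[OF fin q] S by blast
    then show "vec (card S) (\<lambda>q. col B c $ (sorted_list_of_set S ! q)) $ q = col (select_rows S B) c $ q"
      using q rc(2) B by (simp add: index_select_rows)
  qed simp
  then have "F *\<^sub>v col (select_rows S B) c = col B c"
    using mat_image_normalized(3)[OF S F one cols[OF rc(2)]] by simp
  then have "(F *\<^sub>v col (select_rows S B) c) $ r = col B c $ r" by simp
  then show "(F * select_rows S B) $$ (r, c) = B $$ (r, c)" using rc B F by simp
qed (use F B in simp_all)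

text \<open>Applied to an injective frame f_j, this shows that the relation determines the arrow map
  U_\<alpha>.\<close>

lemma mult_mat_left_cancel:
  fixes F :: "'f :: field mat"
  assumes F: "F \<in> carrier_mat n k" and inj: "inj_on (\<lambda>v. F *\<^sub>v v) (carrier_vec k)"
    and B: "B \<in> carrier_mat k l" "B' \<in> carrier_mat k l" and eq: "F * B = F * B'"
  shows "B = B'"
proof (rule eq_matI)
  fix r c assume "r < dim_row B'" "c < dim_col B'"
  then have rc: "r < k" "c < l" using B by simp_all
  have "F *\<^sub>v col B c = F *\<^sub>v col B' c"
    unfolding col_mult2[OF F B(1) rc(2), symmetric] col_mult2[OF F B(2) rc(2), symmetric] eq ..
  then have "col B c = col B' c" using inj B rc by (auto dest!: inj_onD)
  then have "col B c $ r = col B' c $ r" by simp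
  then show "B $$ (r, c) = B' $$ (r, c)" using rc B by simp
qed (use B in simp_all)

lemma inj_mult_invertible:
  fixes F :: "'f :: field mat"
  assumes F: "F \<in> carrier_mat n k" and inj: "inj_on (\<lambda>v. F *\<^sub>v v) (carrier_vec k)"
    and h: "h \<in> carrier_mat k k" and g: "g \<in> carrier_mat k k" and gh: "g * h = 1\<^sub>m k"
  shows "inj_on (\<lambda>v. (F * h) *\<^sub>v v) (carrier_vec k)"
proof (rule inj_onI)
  fix u v assume u: "u \<in> carrier_vec k" and v: "v \<in> carrier_vec k" and "(F * h) *\<^sub>v u = (F * h) *\<^sub>v v"
  then have "F *\<^sub>v (h *\<^sub>v u) = F *\<^sub>v (h *\<^sub>v v)" using assoc_mult_mat_vec[OF F h] by metis
  then have "h *\<^sub>v u = h *\<^sub>v v" using inj h u v by (auto dest!: inj_onD)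
  then have "(g * h) *\<^sub>v u = (g * h) *\<^sub>v v" using assoc_mult_mat_vec[OF g h] u v by metis
  then show "u = v" unfolding gh using u v by simp
qed

lemma invertible_mat_iff:
  fixes g :: "'f :: field mat"
  assumes g: "g \<in> carrier_mat n n"
  shows "invertible_mat g \<longleftrightarrow> (\<exists>h\<in>carrier_mat n n. g * h = 1\<^sub>m n \<and> h * g = 1\<^sub>m n)"
proof
  assume "invertible_mat g"
  then obtain h where h: "g * h = 1\<^sub>m n" "h * g = 1\<^sub>m (dim_row h)"
    using g unfolding invertible_mat_def inverts_mat_def by auto
  \<comment> \<open>Invertibility as defined does not prescribe the format of \<open>h\<close>; it
    is read off from the sizes of the two identity matrices.\<close>
  have "dim_col h = n" using arg_cong[OF h(1), of dim_col] by simp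
  moreover have "dim_row h = n" using arg_cong[OF h(2), of dim_col] g by simp
  ultimately show "\<exists>h\<in>carrier_mat n n. g * h = 1\<^sub>m n \<and> h * g = 1\<^sub>m n"
    using h by (intro bexI[of _ h]) auto
next
  assume "\<exists>h\<in>carrier_mat n n. g * h = 1\<^sub>m n \<and> h * g = 1\<^sub>m n"
  then show "invertible_mat g" using g unfolding invertible_mat_def inverts_mat_def by auto
qed

subsection \<open>Matrices of regular functions\<close>

definition regular_mat :: "('x, 'k :: field) kspace \<Rightarrow> 'x set \<Rightarrow> nat \<Rightarrow> nat \<Rightarrow> ('x \<Rightarrow> 'k alg_closure mat) \<Rightarrow> bool"
  where "regular_mat E U n k F \<longleftrightarrow> (\<forall>x\<in>U. F x \<in> carrier_mat n k) \<and>
    (\<forall>r<n. \<forall>c<k. (\<lambda>x. F x $$ (r, c)) \<in> regular E U)"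

lemma regular_mat_carrier: "regular_mat E U n k F \<Longrightarrow> x \<in> U \<Longrightarrow> F x \<in> carrier_mat n k"
  and regular_mat_entry: "regular_mat E U n k F \<Longrightarrow> r < n \<Longrightarrow> c < k \<Longrightarrow> (\<lambda>x. F x $$ (r, c)) \<in> regular E U"
  by (simp_all add: regular_mat_def)

lemma regular_mat_mult:
  assumes U: "openin (zariski (embedded_space D C)) U"
    and F: "regular_mat (embedded_space D C) U n k F" and F': "regular_mat (embedded_space D C) U k l F'"
  shows "regular_mat (embedded_space D C) U n l (\<lambda>x. F x * F' x)"
  unfolding regular_mat_def
proof (intro conjI ballI allI impI)
  fix x assume "x \<in> U"
  then show "F x * F' x \<in> carrier_mat n l"
    using regular_mat_carrier[OF F] regular_mat_carrier[OF F'] by (simp add: mult_carrier_mat[of _ n k])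
next
  fix r c assume rc: "r < n" "c < l"
  have "(\<lambda>x. \<Sum>j<k. F x $$ (r, j) * F' x $$ (j, c)) \<in> regular (embedded_space D C) U"
    by (intro regular_sum[OF U] regular_mult regular_mat_entry[OF F] regular_mat_entry[OF F']) (use rc in auto)
  then show "(\<lambda>x. (F x * F' x) $$ (r, c)) \<in> regular (embedded_space D C) U"
  proof (rule regular_cong)
    fix x assume "x \<in> U"
    then have "F x \<in> carrier_mat n k" "F' x \<in> carrier_mat k l"
      using regular_mat_carrier[OF F] regular_mat_carrier[OF F'] by blast+
    then show "(\<Sum>j<k. F x $$ (r, j) * F' x $$ (j, c)) = (F x * F' x) $$ (r, c)"
      using rc by (simp add: scalar_prod_def atLeast0LessThan)
  qed
qed

text \<open>The entries come from k: a constant of K outside k need not be a regular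
  function.\<close>

lemma regular_mat_const:
  assumes "openin (zariski (embedded_space D C)) U" "A \<in> carrier_mat n k"
  shows "regular_mat (embedded_space D C) U n k (\<lambda>_. map_mat to_ac A)"
  unfolding regular_mat_def using assms(2) by (auto intro!: regular_const[OF assms(1)])

lemma regular_mat_select_rows:
  assumes F: "regular_mat (embedded_space D C) U n k F" and S: "S \<subseteq> {..<n}"
  shows "regular_mat (embedded_space D C) U (card S) k (\<lambda>x. select_rows S (F x))"
  unfolding regular_mat_def
proof (intro conjI ballI allI impI)
  fix x assume "x \<in> U"
  then show "select_rows S (F x) \<in> carrier_mat (card S) k"
    using regular_mat_carrier[OF F] select_rows_carrier by blast
next
  fix r c assume rc: "r < card S" "c < k"
  have "sorted_list_of_set S ! r < n"
    using nth_sorted_list_of_set_in[OF _ rc(1)] S finite_subset by blast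
  from regular_mat_entry[OF F this rc(2)]
  show "(\<lambda>x. select_rows S (F x) $$ (r, c)) \<in> regular (embedded_space D C) U"
  proof (rule regular_cong)
    fix x assume "x \<in> U"
    then have "F x \<in> carrier_mat n k" by (rule regular_mat_carrier[OF F])
    then show "F x $$ (sorted_list_of_set S ! r, c) = select_rows S (F x) $$ (r, c)"
      using rc by (simp add: index_select_rows)
  qed
qed

text \<open>The Leibniz formula is a polynomial in the entries whose coefficients 1 and -1 lie in
  k.\<close>

lemma regular_det:
  assumes U: "openin (zariski (embedded_space D C)) U" and F: "regular_mat (embedded_space D C) U n n F"
  shows "(\<lambda>x. det (F x)) \<in> regular (embedded_space D C) U"
proof -
  have "(\<lambda>x. \<Sum>p\<in>{p. p permutes {0..<n}}. to_ac (of_int (sign p)) * (\<Prod>i = 0..<n. F x $$ (i, p i)))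
      \<in> regular (embedded_space D C) U"
  proof (intro regular_sum[OF U] regular_mult regular_const[OF U] regular_prod[OF U] regular_mat_entry[OF F])
    fix p i assume "p \<in> {p. p permutes {0..<n}}" "i \<in> {0..<n}"
    then show "i < n" "p i < n" using permutes_in_image[of p "{0..<n}" i] by auto
  qed
  then show ?thesis
    by (rule regular_cong) (simp add: det_def'[OF regular_mat_carrier[OF F]])
qed

lemma regular_mat_inverse_mat:
  assumes U: "openin (zariski (embedded_space D C)) U" and F: "regular_mat (embedded_space D C) U n n F"
    and det: "\<And>x. x \<in> U \<Longrightarrow> det (F x) \<noteq> 0"
  shows "regular_mat (embedded_space D C) U n n (\<lambda>x. inverse_mat (F x))"
  unfolding regular_mat_def
proof (intro conjI ballI allI impI)
  fix x assume x: "x \<in> U"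
  then show "inverse_mat (F x) \<in> carrier_mat n n"
    using inverse_mat(1) regular_mat_carrier[OF F] det by blast
next
  fix r c assume rc: "r < n" "c < n"
  \<comment> \<open>The adjugate is a transpose: its entry at (r, c) is the signed minor without row
    \<open>c\<close> and column \<open>r\<close>.\<close>
  have "regular_mat (embedded_space D C) U (n - 1) (n - 1) (\<lambda>x. mat_delete (F x) c r)"
    unfolding regular_mat_def
  proof (intro conjI ballI allI impI)
    fix x assume "x \<in> U"
    then have "F x \<in> carrier_mat n n" by (rule regular_mat_carrier[OF F])
    then show "mat_delete (F x) c r \<in> carrier_mat (n - 1) (n - 1)"
      by (simp add: mat_delete_def)
  next
    fix i j assume ij: "i < n - 1" "j < n - 1"
    \<comment> \<open>Past the deleted row or column, indices of the minor are shifted by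
      one.\<close>
    have "(\<lambda>x. F x $$ (if i < c then i else Suc i, if j < r then j else Suc j))
        \<in> regular (embedded_space D C) U"
      by (rule regular_mat_entry[OF F]) (use ij in auto)
    then show "(\<lambda>x. mat_delete (F x) c r $$ (i, j)) \<in> regular (embedded_space D C) U"
    proof (rule regular_cong)
      fix x assume "x \<in> U"
      then have "F x \<in> carrier_mat n n" by (rule regular_mat_carrier[OF F])
      then show "F x $$ (if i < c then i else Suc i, if j < r then j else Suc j) = mat_delete (F x) c r $$ (i, j)"
        using ij by (simp add: mat_delete_def)
    qed
  qed
  then have "(\<lambda>x. to_ac ((- 1) ^ (c + r)) * det (mat_delete (F x) c r) / det (F x))
      \<in> regular (embedded_space D C) U"
    by (intro regular_divide regular_mult regular_const[OF U] regular_det[OF U _] regular_det[OF U F] det)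
  then show "(\<lambda>x. inverse_mat (F x) $$ (r, c)) \<in> regular (embedded_space D C) U"
  proof (rule regular_cong)
    fix x assume "x \<in> U"
    then have "F x \<in> carrier_mat n n" by (rule regular_mat_carrier[OF F])
    then show "to_ac ((- 1) ^ (c + r)) * det (mat_delete (F x) c r) / det (F x) = inverse_mat (F x) $$ (r, c)"
      using rc by (simp add: inverse_mat_def adj_mat_def cofactor_def)
  qed
qed

subsection \<open>Framed representations\<close>

lemma carrier_GL_group:
  "g \<in> carrier (GL_group Q e) \<longleftrightarrow> g \<in> extensional (verts Q) \<and>
    (\<forall>i\<in>verts Q. g i \<in> carrier_mat (e i) (e i) \<and> invertible_mat (g i))"
  by (auto simp: GL_group_def PiE_iff)

lemma GL_groupI:
  fixes g h :: "'i \<Rightarrow> 'f :: field mat"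
  assumes "\<And>i. i \<in> verts Q \<Longrightarrow> g i \<in> carrier_mat (e i) (e i)"
    "\<And>i. i \<in> verts Q \<Longrightarrow> h i \<in> carrier_mat (e i) (e i)"
    "\<And>i. i \<in> verts Q \<Longrightarrow> g i * h i = 1\<^sub>m (e i)"
    "\<And>i. i \<in> verts Q \<Longrightarrow> h i * g i = 1\<^sub>m (e i)"
  shows "restrict g (verts Q) \<in> carrier (GL_group Q e)"
proof -
  have "invertible_mat (g i)" if "i \<in> verts Q" for i
    unfolding invertible_mat_iff[OF assms(1)[OF that]] using assms(2-4)[OF that] by blast
  then show ?thesis using assms(1) by (simp add: carrier_GL_group)
qed

lemma GL_groupE:
  fixes g :: "'i \<Rightarrow> 'f :: field mat"
  assumes "g \<in> carrier (GL_group Q e)"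
  obtains h where "h \<in> carrier (GL_group Q e)"
    "\<And>i. i \<in> verts Q \<Longrightarrow> g i * h i = 1\<^sub>m (e i)"
    "\<And>i. i \<in> verts Q \<Longrightarrow> h i * g i = 1\<^sub>m (e i)"
proof -
  have "\<forall>i\<in>verts Q. \<exists>h\<in>carrier_mat (e i) (e i). g i * h = 1\<^sub>m (e i) \<and> h * g i = 1\<^sub>m (e i)"
    using assms invertible_mat_iff unfolding carrier_GL_group by blast
  then obtain h where h: "\<forall>i\<in>verts Q. h i \<in> carrier_mat (e i) (e i) \<and>
      g i * h i = 1\<^sub>m (e i) \<and> h i * g i = 1\<^sub>m (e i)" by metis
  have "restrict h (verts Q) \<in> carrier (GL_group Q e)"
    by (rule GL_groupI[of Q h e g]) (use h assms in \<open>simp_all add: carrier_GL_group\<close>)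
  then show thesis by (rule that) (use h in simp_all)
qed

lemma group_GL_group: "group (GL_group Q e :: ('i \<Rightarrow> 'f :: field mat) monoid)"
proof (rule groupI)
  fix x y :: "'i \<Rightarrow> 'f mat"
  assume x: "x \<in> carrier (GL_group Q e)" and y: "y \<in> carrier (GL_group Q e)"
  obtain x' where x': "x' \<in> carrier (GL_group Q e)" "\<And>i. i \<in> verts Q \<Longrightarrow> x i * x' i = 1\<^sub>m (e i)"
    "\<And>i. i \<in> verts Q \<Longrightarrow> x' i * x i = 1\<^sub>m (e i)" using x by (rule GL_groupE) blast
  obtain y' where y': "y' \<in> carrier (GL_group Q e)" "\<And>i. i \<in> verts Q \<Longrightarrow> y i * y' i = 1\<^sub>m (e i)"
    "\<And>i. i \<in> verts Q \<Longrightarrow> y' i * y i = 1\<^sub>m (e i)" using y by (rule GL_groupE) blast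
  have cancel: "(a * b) * (b' * a') = 1\<^sub>m n"
    if "a \<in> carrier_mat n n" "b \<in> carrier_mat n n" "b' \<in> carrier_mat n n" "a' \<in> carrier_mat n n"
      "b * b' = 1\<^sub>m n" "a * a' = 1\<^sub>m n" for a b b' a' :: "'f mat" and n
  proof -
    have "(a * b) * (b' * a') = a * (b * b' * a')"
      using that(1-4) by (simp add: assoc_mult_mat[of _ n n _ n _ n])
    then show ?thesis using that by simp
  qed
  have "restrict (\<lambda>i. x i * y i) (verts Q) \<in> carrier (GL_group Q e)"
  proof (rule GL_groupI[of Q _ e "\<lambda>i. y' i * x' i"])
    fix i assume i: "i \<in> verts Q"
    have c: "x i \<in> carrier_mat (e i) (e i)" "y i \<in> carrier_mat (e i) (e i)"
      "x' i \<in> carrier_mat (e i) (e i)" "y' i \<in> carrier_mat (e i) (e i)"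
      using x y x'(1) y'(1) i by (simp_all add: carrier_GL_group)
    show "x i * y i \<in> carrier_mat (e i) (e i)" "y' i * x' i \<in> carrier_mat (e i) (e i)"
      using c by (simp_all add: mult_carrier_mat[of _ _ "e i"])
    show "x i * y i * (y' i * x' i) = 1\<^sub>m (e i)" "y' i * x' i * (x i * y i) = 1\<^sub>m (e i)"
      using cancel c x'(2,3)[OF i] y'(2,3)[OF i] by simp_all
  qed
  then show "x \<otimes>\<^bsub>GL_group Q e\<^esub> y \<in> carrier (GL_group Q e)" by (simp add: GL_group_def)
next
  have "restrict (\<lambda>i. 1\<^sub>m (e i)) (verts Q) \<in> carrier (GL_group Q e :: ('i \<Rightarrow> 'f mat) monoid)"
    by (rule GL_groupI[of Q _ e "\<lambda>i. 1\<^sub>m (e i)"]) simp_all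
  then show "\<one>\<^bsub>GL_group Q e\<^esub> \<in> carrier (GL_group Q e :: ('i \<Rightarrow> 'f mat) monoid)"
    by (simp add: GL_group_def)
next
  fix x y z :: "'i \<Rightarrow> 'f mat"
  assume "x \<in> carrier (GL_group Q e)" "y \<in> carrier (GL_group Q e)" "z \<in> carrier (GL_group Q e)"
  then have "x i * y i * z i = x i * (y i * z i)" if "i \<in> verts Q" for i
    using that unfolding carrier_GL_group by (intro assoc_mult_mat[of _ "e i" "e i" _ "e i" _ "e i"]) auto
  then show "x \<otimes>\<^bsub>GL_group Q e\<^esub> y \<otimes>\<^bsub>GL_group Q e\<^esub> z =
      x \<otimes>\<^bsub>GL_group Q e\<^esub> (y \<otimes>\<^bsub>GL_group Q e\<^esub> z)"
    by (auto simp: GL_group_def intro!: restrict_ext)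
next
  fix x :: "'i \<Rightarrow> 'f mat"
  assume x: "x \<in> carrier (GL_group Q e)"
  then have "(\<lambda>i\<in>verts Q. 1\<^sub>m (e i) * x i) = x"
    unfolding carrier_GL_group by (intro extensionalityI[of _ "verts Q"]) auto
  then show "\<one>\<^bsub>GL_group Q e\<^esub> \<otimes>\<^bsub>GL_group Q e\<^esub> x = x"
    by (simp add: GL_group_def cong: restrict_cong)
  obtain y where y: "y \<in> carrier (GL_group Q e)" "\<And>i. i \<in> verts Q \<Longrightarrow> y i * x i = 1\<^sub>m (e i)"
    using x by (rule GL_groupE) blast
  show "\<exists>y\<in>carrier (GL_group Q e). y \<otimes>\<^bsub>GL_group Q e\<^esub> x = \<one>\<^bsub>GL_group Q e\<^esub>"
    by (rule bexI[OF _ y(1)]) (auto simp: GL_group_def y(2) intro!: restrict_ext)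
qed

lemma inv_GL_group_eqI:
  fixes g h :: "'i \<Rightarrow> 'f :: field mat"
  assumes "g \<in> carrier (GL_group Q e)" "h \<in> carrier (GL_group Q e)"
    "\<And>i. i \<in> verts Q \<Longrightarrow> h i * g i = 1\<^sub>m (e i)"
  shows "inv\<^bsub>GL_group Q e\<^esub> g = h"
  by (rule group.inv_equality[OF group_GL_group _ assms(1,2)])
    (auto simp: GL_group_def assms(3) intro!: restrict_ext)

lemma inv_GL_group:
  fixes g :: "'i \<Rightarrow> 'f :: field mat"
  assumes g: "g \<in> carrier (GL_group Q e)" and i: "i \<in> verts Q"
  shows "(inv\<^bsub>GL_group Q e\<^esub> g) i \<in> carrier_mat (e i) (e i)"
    "g i * (inv\<^bsub>GL_group Q e\<^esub> g) i = 1\<^sub>m (e i)" "(inv\<^bsub>GL_group Q e\<^esub> g) i * g i = 1\<^sub>m (e i)"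
proof -
  obtain h where h: "h \<in> carrier (GL_group Q e)"
    "\<And>i. i \<in> verts Q \<Longrightarrow> g i * h i = 1\<^sub>m (e i)"
    "\<And>i. i \<in> verts Q \<Longrightarrow> h i * g i = 1\<^sub>m (e i)"
    using g by (rule GL_groupE) blast
  have "inv\<^bsub>GL_group Q e\<^esub> g = h" by (rule inv_GL_group_eqI[OF g h(1,3)])
  then show "(inv\<^bsub>GL_group Q e\<^esub> g) i \<in> carrier_mat (e i) (e i)"
    "g i * (inv\<^bsub>GL_group Q e\<^esub> g) i = 1\<^sub>m (e i)" "(inv\<^bsub>GL_group Q e\<^esub> g) i * g i = 1\<^sub>m (e i)"
    using h i by (simp_all add: carrier_GL_group)
qed

section \<open>Framed representations and their images\<close>

locale framed_quiver = fin_digraph Q for Q :: "('i, 'a) pre_digraph" +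
  fixes A :: "'a \<Rightarrow> 'k :: field mat" and m e :: "'i \<Rightarrow> nat"
  assumes A_carrier: "\<And>\<alpha>. \<alpha> \<in> arcs Q \<Longrightarrow> A \<alpha> \<in> carrier_mat (m (head Q \<alpha>)) (m (tail Q \<alpha>))"
begin

abbreviation "AK \<alpha> \<equiv> map_mat to_ac (A \<alpha>)"
abbreviation "points0 \<equiv> hom0_points Q A m e"
abbreviation "chart_set S \<equiv> subrepresentations Q A m e \<inter> chart_domain Q m S"

definition image_rep :: "('a \<Rightarrow> 'k alg_closure mat) \<times> ('i \<Rightarrow> 'k alg_closure mat) \<Rightarrow> 'i \<Rightarrow> 'k alg_closure vec set"
  where "image_rep x = (\<lambda>i\<in>verts Q. mat_image (snd x i))"

text \<open>Extends normalized frames by the only possible arrow maps: identity rows of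
  \<open>F (head Q \<alpha>)\<close> at \<open>S (head Q \<alpha>)\<close> turn the relation at
  \<alpha> into this formula.\<close>

definition complete :: "('i \<Rightarrow> nat set) \<Rightarrow> ('i \<Rightarrow> 'k alg_closure mat) \<Rightarrow>
    ('a \<Rightarrow> 'k alg_closure mat) \<times> ('i \<Rightarrow> 'k alg_closure mat)"
  where "complete S F = ((\<lambda>\<alpha>\<in>arcs Q. select_rows (S (head Q \<alpha>)) (AK \<alpha> * F (tail Q \<alpha>))), \<lambda>i\<in>verts Q. F i)"

definition "slice S N = complete S (\<lambda>i. frame (m i) (S i) (N i))"

lemma AK_carrier: "\<alpha> \<in> arcs Q \<Longrightarrow> AK \<alpha> \<in> carrier_mat (m (head Q \<alpha>)) (m (tail Q \<alpha>))"
  using A_carrier by simp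

lemma chart_index:
  "S \<in> chart_indices Q m e \<Longrightarrow> i \<in> verts Q \<Longrightarrow> S i \<subseteq> {..<m i}"
  "S \<in> chart_indices Q m e \<Longrightarrow> i \<in> verts Q \<Longrightarrow> card (S i) = e i"
  by (auto simp: chart_indices_def)

lemma chart_domain_iff: "N \<in> chart_domain Q m S \<longleftrightarrow> (\<forall>i\<in>verts Q. complemented (m i) (S i) (N i))"
  by (simp add: chart_domain_def complemented_def)

lemma points0D:
  assumes "x \<in> points0"
  shows "\<And>\<alpha>. \<alpha> \<in> arcs Q \<Longrightarrow> fst x \<alpha> \<in> carrier_mat (e (head Q \<alpha>)) (e (tail Q \<alpha>))"
    and "\<And>i. i \<in> verts Q \<Longrightarrow> snd x i \<in> carrier_mat (m i) (e i)"
    and "\<And>i. i \<in> verts Q \<Longrightarrow> inj_on (\<lambda>v. snd x i *\<^sub>v v) (carrier_vec (e i))"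
    and "\<And>\<alpha>. \<alpha> \<in> arcs Q \<Longrightarrow> AK \<alpha> * snd x (tail Q \<alpha>) = snd x (head Q \<alpha>) * fst x \<alpha>"
  using assms by (auto simp: hom0_points_def)

text \<open>The relation carries A_\<alpha> past the frames: A_\<alpha> f_i u = f_j (U_\<alpha> u)
  lies in the image of f_j.\<close>

lemma image_rep_subrep:
  assumes x: "x \<in> points0"
  shows "image_rep x \<in> subrepresentations Q A m e"
  unfolding subrepresentations_def
proof (intro CollectI conjI ballI)
  show "image_rep x \<in> (\<Pi>\<^sub>E i\<in>verts Q. subspaces (m i) (e i))"
    using mat_image_in_subspaces[OF points0D(2,3)[OF x]] by (auto simp: image_rep_def)
  fix \<alpha> v assume \<alpha>: "\<alpha> \<in> arcs Q" and v: "v \<in> image_rep x (tail Q \<alpha>)"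
  let ?i = "tail Q \<alpha>" and ?j = "head Q \<alpha>"
  have i: "?i \<in> verts Q" and j: "?j \<in> verts Q" using \<alpha> by auto
  note f = points0D(2)[OF x]
  obtain u where u: "u \<in> carrier_vec (e ?i)" "v = snd x ?i *\<^sub>v u"
    using v i f[OF i] by (auto simp: image_rep_def mat_image_def)
  have "AK \<alpha> *\<^sub>v v = (AK \<alpha> * snd x ?i) *\<^sub>v u"
    unfolding u(2) by (rule assoc_mult_mat_vec[OF AK_carrier[OF \<alpha>] f[OF i] u(1), symmetric])
  also have "\<dots> = snd x ?j *\<^sub>v (fst x \<alpha> *\<^sub>v u)"
    unfolding points0D(4)[OF x \<alpha>] by (rule assoc_mult_mat_vec[OF f[OF j] points0D(1)[OF x \<alpha>] u(1)])
  finally show "AK \<alpha> *\<^sub>v v \<in> image_rep x ?j"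
    using f[OF j] j points0D(1)[OF x \<alpha>] u(1) by (auto simp: image_rep_def mat_image_def)
qed

text \<open>Stability puts the columns of A_\<alpha> F_i into the image of F_j, so
  \<open>normalized_factor\<close> gives the relation. Injectivity comes from the identity block,
  whose determinant is 1.\<close>

lemma complete_in:
  assumes S: "S \<in> chart_indices Q m e"
    and F: "\<And>i. i \<in> verts Q \<Longrightarrow> F i \<in> carrier_mat (m i) (e i)"
    and one: "\<And>i. i \<in> verts Q \<Longrightarrow> select_rows (S i) (F i) = 1\<^sub>m (e i)"
    and stable: "\<And>\<alpha> v. \<alpha> \<in> arcs Q \<Longrightarrow> v \<in> mat_image (F (tail Q \<alpha>)) \<Longrightarrow> AK \<alpha> *\<^sub>v v \<in> mat_image (F (head Q \<alpha>))"
  shows "complete S F \<in> points0"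
proof -
  have U: "select_rows (S (head Q \<alpha>)) (AK \<alpha> * F (tail Q \<alpha>)) \<in> carrier_mat (e (head Q \<alpha>)) (e (tail Q \<alpha>))"
    if "\<alpha> \<in> arcs Q" for \<alpha>
    using select_rows_carrier[of "AK \<alpha> * F (tail Q \<alpha>)" "m (head Q \<alpha>)" "e (tail Q \<alpha>)" "S (head Q \<alpha>)"]
      AK_carrier[OF that] F[of "tail Q \<alpha>"] chart_index(2)[OF S] that by auto
  have inj: "inj_on (\<lambda>v. F i *\<^sub>v v) (carrier_vec (e i))" if i: "i \<in> verts Q" for i
    using normalize_rows(3)[of "S i" "m i" "F i"] chart_index[OF S i] F[OF i] one[OF i] by simp
  have rel: "AK \<alpha> * F (tail Q \<alpha>) = F (head Q \<alpha>) * select_rows (S (head Q \<alpha>)) (AK \<alpha> * F (tail Q \<alpha>))"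
    if \<alpha>: "\<alpha> \<in> arcs Q" for \<alpha>
  proof -
    let ?i = "tail Q \<alpha>" and ?j = "head Q \<alpha>"
    have i: "?i \<in> verts Q" and j: "?j \<in> verts Q" using \<alpha> by auto
    have "col (AK \<alpha> * F ?i) c \<in> mat_image (F ?j)" if c: "c < e ?i" for c
    proof -
      have "col (F ?i) c = F ?i *\<^sub>v unit_vec (e ?i) c" using mult_unit_vec[OF F[OF i] c] by simp
      then have "col (F ?i) c \<in> mat_image (F ?i)"
        using F[OF i] c by (auto simp: mat_image_def)
      then show ?thesis
        using stable[OF \<alpha>] col_mult2[OF AK_carrier[OF \<alpha>] F[OF i] c] by simp
    qed
    then show ?thesis
      using normalized_factor[of "S ?j" "m ?j" "F ?j" "AK \<alpha> * F ?i" "e ?i"]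
        chart_index[OF S j] F[OF j] F[OF i] one[OF j] AK_carrier[OF \<alpha>] by simp
  qed
  show ?thesis
    unfolding hom0_points_def complete_def using U inj rel F by auto
qed

lemma slice_frame:
  assumes S: "S \<in> chart_indices Q m e" and N: "N \<in> chart_set S" and i: "i \<in> verts Q"
  shows "frame (m i) (S i) (N i) \<in> carrier_mat (m i) (e i)"
    and "select_rows (S i) (frame (m i) (S i) (N i)) = 1\<^sub>m (e i)"
    and "mat_image (frame (m i) (S i) (N i)) = N i"
proof -
  show "frame (m i) (S i) (N i) \<in> carrier_mat (m i) (e i)"
    using chart_index[OF S i] by (simp add: frame_def)
  have "VectorSpace.subspace class_ring (N i) (module_vec TYPE('k alg_closure) (m i))"
    using N i by (auto simp: subrepresentations_def subspaces_def)
  moreover have "complemented (m i) (S i) (N i)" using N i by (simp add: chart_domain_iff)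
  ultimately show "select_rows (S i) (frame (m i) (S i) (N i)) = 1\<^sub>m (e i)"
    "mat_image (frame (m i) (S i) (N i)) = N i"
    using frame_of_subspace[of "S i" "m i" "N i"] chart_index[OF S i] by simp_all
qed

lemma slice_in:
  assumes S: "S \<in> chart_indices Q m e" and N: "N \<in> chart_set S"
  shows "slice S N \<in> points0"
  unfolding slice_def
proof (rule complete_in[OF S])
  fix \<alpha> v assume \<alpha>: "\<alpha> \<in> arcs Q"
    and v: "v \<in> mat_image (frame (m (tail Q \<alpha>)) (S (tail Q \<alpha>)) (N (tail Q \<alpha>)))"
  have "tail Q \<alpha> \<in> verts Q" "head Q \<alpha> \<in> verts Q" using \<alpha> by auto
  then show "AK \<alpha> *\<^sub>v v \<in> mat_image (frame (m (head Q \<alpha>)) (S (head Q \<alpha>)) (N (head Q \<alpha>)))"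
    using v N \<alpha> slice_frame(3)[OF S N] by (auto simp: subrepresentations_def)
qed (use slice_frame[OF S N] in simp_all)

lemma image_rep_slice:
  assumes S: "S \<in> chart_indices Q m e" and N: "N \<in> chart_set S"
  shows "image_rep (slice S N) = N"
proof (rule extensionalityI[of _ "verts Q"])
  show "N \<in> extensional (verts Q)" using N by (auto simp: subrepresentations_def PiE_iff)
qed (simp_all add: image_rep_def slice_def complete_def slice_frame(3)[OF S N])

text \<open>Characterizes the slice by equations: frames with identity rows are recovered from their
  images by \<open>mat_image_normalized\<close>, and the arrow maps by reading the relation in the
  selected rows. This is the half needed to see that the slice is closed.\<close>

lemma slice_image_rep:
  assumes S: "S \<in> chart_indices Q m e" and x: "x \<in> points0"
    and one: "\<And>i. i \<in> verts Q \<Longrightarrow> select_rows (S i) (snd x i) = 1\<^sub>m (e i)"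
  shows "image_rep x \<in> chart_set S" and "slice S (image_rep x) = x"
proof -
  note f = points0D[OF x]
  have norm: "complemented (m i) (S i) (mat_image (snd x i))" "frame (m i) (S i) (mat_image (snd x i)) = snd x i"
    if i: "i \<in> verts Q" for i
    using mat_image_normalized(1,2)[of "S i" "m i" "snd x i"] chart_index[OF S i] f(2)[OF i] one[OF i] by simp_all
  show "image_rep x \<in> chart_set S"
    using image_rep_subrep[OF x] norm(1) by (simp add: chart_domain_iff image_rep_def)
  have "select_rows (S (head Q \<alpha>)) (AK \<alpha> * snd x (tail Q \<alpha>)) = fst x \<alpha>" if \<alpha>: "\<alpha> \<in> arcs Q" for \<alpha>
  proof -
    have j: "head Q \<alpha> \<in> verts Q" using \<alpha> by auto
    show ?thesis
      unfolding f(4)[OF \<alpha>] using select_rows_mult[of "S (head Q \<alpha>)" "snd x (head Q \<alpha>)" "fst x \<alpha>"]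
        chart_index(1)[OF S j] f(2)[OF j] f(1)[OF \<alpha>] one[OF j] by simp
  qed
  then have "fst (slice S (image_rep x)) = fst x"
    using x by (intro extensionalityI[of _ "arcs Q"])
      (auto simp: slice_def complete_def image_rep_def norm(2) hom0_points_def PiE_iff)
  moreover have "snd (slice S (image_rep x)) = snd x"
    using x by (intro extensionalityI[of _ "verts Q"])
      (auto simp: slice_def complete_def image_rep_def norm(2) hom0_points_def PiE_iff)
  ultimately show "slice S (image_rep x) = x" by (rule prod_eqI)
qed

text \<open>Translates membership in a chart into nonvanishing minors, which is what makes its
  preimage open.\<close>

lemma image_rep_in_domain_iff:
  assumes S: "S \<in> chart_indices Q m e" and x: "x \<in> points0"
  shows "image_rep x \<in> chart_set S \<longleftrightarrow> (\<forall>i\<in>verts Q. det (select_rows (S i) (snd x i)) \<noteq> 0)"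
proof -
  have "complemented (m i) (S i) (mat_image (snd x i)) \<longleftrightarrow> det (select_rows (S i) (snd x i)) \<noteq> 0"
    if i: "i \<in> verts Q" for i
    using normalize_rows(1)[of "S i" "m i" "snd x i"] det_nonzero_if_complemented[of "S i" "m i" "snd x i"]
      chart_index[OF S i] points0D(2,3)[OF x i] by auto
  then show ?thesis using image_rep_subrep[OF x] by (simp add: chart_domain_iff image_rep_def)
qed

section \<open>Orbits as fibres of the image map\<close>

lemma act_in:
  assumes g: "g \<in> carrier (GL_group Q e)" and x: "x \<in> points0"
  shows "GL_act Q e g x \<in> points0" and "image_rep (GL_act Q e g x) = image_rep x"
proof -
  define h where "h = inv\<^bsub>GL_group Q e\<^esub> g"
  have gi: "g i \<in> carrier_mat (e i) (e i)" if "i \<in> verts Q" for i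
    using g that by (simp add: carrier_GL_group)
  note h = inv_GL_group[OF g, folded h_def] and f = points0D[OF x]
  have act: "GL_act Q e g x = ((\<lambda>\<alpha>\<in>arcs Q. g (head Q \<alpha>) * fst x \<alpha> * h (tail Q \<alpha>)), \<lambda>i\<in>verts Q. snd x i * h i)"
    by (simp add: GL_act_def h_def Let_def split: prod.split)
  have rel: "AK \<alpha> * (snd x (tail Q \<alpha>) * h (tail Q \<alpha>)) =
      (snd x (head Q \<alpha>) * h (head Q \<alpha>)) * (g (head Q \<alpha>) * fst x \<alpha> * h (tail Q \<alpha>))"
    if \<alpha>: "\<alpha> \<in> arcs Q" for \<alpha>
  proof -
    let ?i = "tail Q \<alpha>" and ?j = "head Q \<alpha>"
    have i: "?i \<in> verts Q" and j: "?j \<in> verts Q" using \<alpha> by auto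
    note c = AK_carrier[OF \<alpha>] f(1)[OF \<alpha>] f(2)[OF i] f(2)[OF j] h(1)[OF i] h(1)[OF j] gi[OF j]
    have gU: "g ?j * fst x \<alpha> * h ?i = g ?j * (fst x \<alpha> * h ?i)"
      by (rule assoc_mult_mat[OF c(7) c(2) c(5)])
    have Uh: "fst x \<alpha> * h ?i \<in> carrier_mat (e ?j) (e ?i)" using c by simp
    have "AK \<alpha> * (snd x ?i * h ?i) = (snd x ?j * fst x \<alpha>) * h ?i"
      unfolding f(4)[OF \<alpha>, symmetric] by (rule assoc_mult_mat[OF c(1) c(3) c(5), symmetric])
    also have "\<dots> = snd x ?j * (fst x \<alpha> * h ?i)" by (rule assoc_mult_mat[OF c(4) c(2) c(5)])
    \<comment> \<open>The identity is inserted at the head vertex as h_j g_j, whose factors then go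
      to the frame and to the arrow map.\<close>
    also have "\<dots> = snd x ?j * ((h ?j * g ?j) * (fst x \<alpha> * h ?i))"
      unfolding h(3)[OF j] left_mult_one_mat[OF Uh] ..
    also have "\<dots> = snd x ?j * (h ?j * (g ?j * (fst x \<alpha> * h ?i)))"
      by (subst assoc_mult_mat[OF c(6) c(7) Uh]) (rule refl)
    also have "\<dots> = (snd x ?j * h ?j) * (g ?j * (fst x \<alpha> * h ?i))"
      by (rule assoc_mult_mat[OF c(4) c(6) mult_carrier_mat[OF c(7) Uh], symmetric])
    finally show ?thesis unfolding gU .
  qed
  have inj: "inj_on (\<lambda>v. (snd x i * h i) *\<^sub>v v) (carrier_vec (e i))" if i: "i \<in> verts Q" for i
    by (rule inj_mult_invertible[OF f(2,3)[OF i] h(1)[OF i] gi[OF i] h(2)[OF i]])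
  have "g (head Q \<alpha>) * fst x \<alpha> * h (tail Q \<alpha>) \<in> carrier_mat (e (head Q \<alpha>)) (e (tail Q \<alpha>))"
    if "\<alpha> \<in> arcs Q" for \<alpha>
    using gi[of "head Q \<alpha>"] f(1)[OF that] h(1)[of "tail Q \<alpha>"] that by auto
  moreover have "snd x i * h i \<in> carrier_mat (m i) (e i)" if "i \<in> verts Q" for i
    using f(2)[OF that] h(1)[OF that] by simp
  ultimately show "GL_act Q e g x \<in> points0"
    unfolding act hom0_points_def using rel inj by auto
  have "mat_image (snd x i * h i) = mat_image (snd x i)" if i: "i \<in> verts Q" for i
    by (rule mat_image_mult_invertible[OF f(2)[OF i] h(1)[OF i] gi[OF i] h(3)[OF i]])
  then show "image_rep (GL_act Q e g x) = image_rep x"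
    unfolding act image_rep_def by (intro restrict_ext) simp
qed

text \<open>The base change is found at each vertex separately, using some nonzero minor of the
  frame there. Once the frames agree, so do the arrow maps, because the relation determines them
  through the injective frames.\<close>

lemma same_image_rep_act:
  assumes x: "x \<in> points0" and y: "y \<in> points0" and eq: "image_rep y = image_rep x"
  obtains g where "g \<in> carrier (GL_group Q e)" "GL_act Q e g x = y"
proof -
  note f = points0D[OF x] and f' = points0D[OF y]
  have "\<exists>g h. g \<in> carrier_mat (e i) (e i) \<and> h \<in> carrier_mat (e i) (e i) \<and>
      g * h = 1\<^sub>m (e i) \<and> h * g = 1\<^sub>m (e i) \<and> snd y i = snd x i * h" if i: "i \<in> verts Q" for i
  proof -
    have im: "mat_image (snd y i) = mat_image (snd x i)"
      using fun_cong[OF eq, of i] i by (simp add: image_rep_def)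
    obtain S where S: "S \<subseteq> {..<m i}" "card S = e i" "det (select_rows S (snd x i)) \<noteq> 0"
      using ex_nonzero_minor[OF f(2,3)[OF i]] by blast
    show ?thesis
      by (rule same_image_normalized[OF S(1) _ _ _ S(3) im])
        (use S(2) f(2)[OF i] f'(2,3)[OF i] in auto)
  qed
  then obtain g h where g: "\<And>i. i \<in> verts Q \<Longrightarrow> g i \<in> carrier_mat (e i) (e i)"
    and h: "\<And>i. i \<in> verts Q \<Longrightarrow> h i \<in> carrier_mat (e i) (e i)"
    and gh: "\<And>i. i \<in> verts Q \<Longrightarrow> g i * h i = 1\<^sub>m (e i)"
    and hg: "\<And>i. i \<in> verts Q \<Longrightarrow> h i * g i = 1\<^sub>m (e i)"
    and yh: "\<And>i. i \<in> verts Q \<Longrightarrow> snd y i = snd x i * h i" by metis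
  \<comment> \<open>The action multiplies frames by inverses, so the matrices \<open>h\<close> with
    f' = f h form the inverse of the required group element.\<close>
  let ?g = "restrict g (verts Q)" and ?h = "restrict h (verts Q)"
  have G: "?g \<in> carrier (GL_group Q e)" "?h \<in> carrier (GL_group Q e)"
    using GL_groupI[of Q g e h, OF g h gh hg] GL_groupI[of Q h e g, OF h g hg gh] by blast+
  have inv: "inv\<^bsub>GL_group Q e\<^esub> ?g = ?h"
    by (rule inv_GL_group_eqI[OF G]) (simp add: hg)
  have act: "GL_act Q e ?g x = ((\<lambda>\<alpha>\<in>arcs Q. ?g (head Q \<alpha>) * fst x \<alpha> * ?h (tail Q \<alpha>)), \<lambda>i\<in>verts Q. snd x i * ?h i)"
    unfolding GL_act_def inv by (simp add: Let_def split: prod.split)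
  have snd: "snd (GL_act Q e ?g x) = snd y"
    using y by (intro extensionalityI[of _ "verts Q"]) (auto simp: act yh hom0_points_def PiE_iff)
  have "fst (GL_act Q e ?g x) \<alpha> = fst y \<alpha>" if \<alpha>: "\<alpha> \<in> arcs Q" for \<alpha>
  proof -
    have j: "head Q \<alpha> \<in> verts Q" using \<alpha> by auto
    note a = points0D[OF act_in(1)[OF G(1) x], unfolded snd]
    show ?thesis
      by (rule mult_mat_left_cancel[OF f'(2,3)[OF j] a(1)[OF \<alpha>] f'(1)[OF \<alpha>]])
        (simp add: a(4)[OF \<alpha>, symmetric] f'(4)[OF \<alpha>, symmetric])
  qed
  then have "fst (GL_act Q e ?g x) = fst y"
    using y act_in(1)[OF G(1) x] by (intro extensionalityI[of _ "arcs Q"])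
      (auto simp: hom0_points_def PiE_iff)
  then have "GL_act Q e ?g x = y" using snd by (rule prod_eqI)
  then show thesis using that G(1) by blast
qed

lemma orbit_image_rep:
  assumes x: "x \<in> points0"
  shows "Group_Action.orbit (GL_group Q e) (GL_act Q e) x = {y \<in> points0. image_rep y = image_rep x}"
  unfolding Group_Action.orbit_def using act_in[OF _ x] same_image_rep_act[OF x] by blast

section \<open>Regularity over k of charts and sections\<close>

lemma regular_hom0_coords:
  assumes U: "openin (zariski (embedded_space points0 (hom0_coords Q m e))) U"
  shows "i \<in> verts Q \<Longrightarrow>
      regular_mat (embedded_space points0 (hom0_coords Q m e)) U (m i) (e i) (\<lambda>x. snd x i)"
proof -
  assume i: "i \<in> verts Q"
  have UX: "U \<subseteq> points0" using openin_subset[OF U] by simp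
  have "(\<lambda>x. snd x i $$ (r, c)) \<in> (hom0_coords Q m e :: (('a \<Rightarrow> 'k alg_closure mat) \<times> _ \<Rightarrow> _) set)"
    if "r < m i" "c < e i" for r c
    using that i by (auto simp: hom0_coords_def case_prod_beta')
  then show ?thesis
    unfolding regular_mat_def using points0D(2) UX i by (auto intro!: regular_kpoly[OF U] kpoly.coord)
qed

lemma openin_domain:
  assumes S: "S \<in> chart_indices Q m e"
  shows "openin (zariski (embedded_space points0 (hom0_coords Q m e))) {x \<in> points0. image_rep x \<in> chart_set S}"
proof -
  let ?E = "embedded_space points0 (hom0_coords Q m e)"
  \<comment> \<open>A single function for all vertices: the finite product is nonzero exactly when
    every minor is.\<close>
  have "(\<lambda>x. \<Prod>i\<in>verts Q. det (select_rows (S i) (snd x i))) \<in> regular ?E points0"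
  proof (intro regular_prod regular_det openin_embedded_space_self)
    fix i assume i: "i \<in> verts Q"
    show "regular_mat ?E points0 (e i) (e i) (\<lambda>x. select_rows (S i) (snd x i))"
      using regular_mat_select_rows[OF regular_hom0_coords[OF openin_embedded_space_self i]
          chart_index(1)[OF S i]] chart_index(2)[OF S i] by simp
  qed
  from openin_nonzero_regular[OF openin_embedded_space_self this]
  have "openin (zariski ?E) {x \<in> points0. (\<Prod>i\<in>verts Q. det (select_rows (S i) (snd x i))) \<noteq> 0}" .
  moreover have "{x \<in> points0. (\<Prod>i\<in>verts Q. det (select_rows (S i) (snd x i))) \<noteq> 0} =
      {x \<in> points0. image_rep x \<in> chart_set S}"
    using image_rep_in_domain_iff[OF S] by auto
  ultimately show ?thesis by simp
qed

text \<open>Entries in rows outside \<open>S i\<close> are chart coordinates by definition; those in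
  rows of \<open>S i\<close> are entries of the identity matrix, hence constants of k.\<close>

lemma regular_frame:
  assumes S: "S \<in> chart_indices Q m e" and i: "i \<in> verts Q"
  shows "regular_mat (embedded_space (chart_set S) (chart_coords Q m S)) (chart_set S) (m i) (e i)
    (\<lambda>N. frame (m i) (S i) (N i))"
  unfolding regular_mat_def
proof (intro conjI ballI allI impI)
  fix N assume "N \<in> chart_set S"
  then show "frame (m i) (S i) (N i) \<in> carrier_mat (m i) (e i)" using slice_frame(1)[OF S] i by blast
next
  fix r c assume rc: "r < m i" "c < e i"
  let ?E = "embedded_space (chart_set S) (chart_coords Q m S)" and ?s = "sorted_list_of_set (S i) ! c"
  have fin: "finite (S i)" using chart_index(1)[OF S i] finite_subset by blast
  have s: "?s \<in> S i" using nth_sorted_list_of_set_in[OF fin] chart_index(2)[OF S i] rc(2) by simp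
  show "(\<lambda>N. frame (m i) (S i) (N i) $$ (r, c)) \<in> regular ?E (chart_set S)"
  proof (cases "r \<in> S i")
    case False
    have "(\<lambda>N. (THE v. v \<in> N i \<and> (\<forall>t\<in>S i. v $ t = (if t = ?s then 1 else 0))) $ r) \<in>
        (chart_coords Q m S :: (('i \<Rightarrow> 'k alg_closure vec set) \<Rightarrow> _) set)"
      unfolding chart_coords_def using i s rc(1) False by blast
    from regular_kpoly[OF openin_embedded_space_self kpoly.coord[OF this]]
    have "(\<lambda>N. (THE v. v \<in> N i \<and> (\<forall>t\<in>S i. v $ t = (if t = ?s then 1 else 0))) $ r) \<in> regular ?E (chart_set S)" .
    then show ?thesis
      by (rule regular_cong) (use rc chart_index(2)[OF S i] in \<open>simp add: frame_def\<close>)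
  next
    case True
    then obtain q where q: "q < card (S i)" "sorted_list_of_set (S i) ! q = r"
      using ex_nth_sorted_list_of_set[OF fin] by blast
    have "(\<lambda>_. to_ac (if q = c then 1 else 0)) \<in> regular ?E (chart_set S)"
      by (rule regular_const) simp
    then show ?thesis
    proof (rule regular_cong)
      fix N assume N: "N \<in> chart_set S"
      have "select_rows (S i) (frame (m i) (S i) (N i)) $$ (q, c) = 1\<^sub>m (e i) $$ (q, c)"
        using slice_frame(2)[OF S N i] by simp
      then show "to_ac (if q = c then 1 else 0) = frame (m i) (S i) (N i) $$ (r, c)"
        using q rc chart_index(2)[OF S i] by (simp add: index_select_rows frame_def)
    qed
  qed
qed

lemma slice_coords:
  assumes S: "S \<in> chart_indices Q m e" and c: "c \<in> hom0_coords Q m e"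
  shows "c \<circ> slice S \<in> regular (embedded_space (chart_set S) (chart_coords Q m S)) (chart_set S)"
proof -
  let ?E = "embedded_space (chart_set S) (chart_coords Q m S)"
  consider \<alpha> r q where "\<alpha> \<in> arcs Q" "r < e (head Q \<alpha>)" "q < e (tail Q \<alpha>)" "c = (\<lambda>(U, f). U \<alpha> $$ (r, q))"
    | i r q where "i \<in> verts Q" "r < m i" "q < e i" "c = (\<lambda>(U, f). f i $$ (r, q))"
    using c unfolding hom0_coords_def by blast
  then show ?thesis
  proof cases
    case 1
    have i: "tail Q \<alpha> \<in> verts Q" and j: "head Q \<alpha> \<in> verts Q" using 1(1) by auto
    have "regular_mat ?E (chart_set S) (e (head Q \<alpha>)) (e (tail Q \<alpha>))
        (\<lambda>N. select_rows (S (head Q \<alpha>)) (AK \<alpha> * frame (m (tail Q \<alpha>)) (S (tail Q \<alpha>)) (N (tail Q \<alpha>))))"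
      using regular_mat_select_rows[OF regular_mat_mult[OF openin_embedded_space_self
            regular_mat_const[OF openin_embedded_space_self A_carrier[OF 1(1)]] regular_frame[OF S i]]
          chart_index(1)[OF S j]] chart_index(2)[OF S j] by simp
    from regular_mat_entry[OF this 1(2,3)] show ?thesis
      by (rule regular_cong) (use 1 in \<open>simp add: slice_def complete_def\<close>)
  next
    case 2
    from regular_mat_entry[OF regular_frame[OF S 2(1)] 2(2,3)] show ?thesis
      by (rule regular_cong) (use 2 in \<open>simp add: slice_def complete_def\<close>)
  qed
qed

lemma image_rep_coords:
  assumes S: "S \<in> chart_indices Q m e" and c: "c \<in> chart_coords Q m S"
  shows "c \<circ> image_rep \<in> regular (embedded_space points0 (hom0_coords Q m e)) {x \<in> points0. image_rep x \<in> chart_set S}"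
proof -
  let ?E = "embedded_space points0 (hom0_coords Q m e)" and ?U = "{x \<in> points0. image_rep x \<in> chart_set S}"
  obtain i s r where *: "i \<in> verts Q" "s \<in> S i" "r < m i"
    and c: "c = (\<lambda>N. (THE v. v \<in> N i \<and> (\<forall>t\<in>S i. v $ t = (if t = s then 1 else 0))) $ r)"
    using c unfolding chart_coords_def by blast
  note idx = chart_index[OF S *(1)]
  have fin: "finite (S i)" using idx(1) finite_subset by blast
  \<comment> \<open>Coordinates are indexed by the element \<open>s\<close>, columns of the frame by
    its position \<open>q\<close> in the enumeration.\<close>
  obtain q where q: "q < e i" "sorted_list_of_set (S i) ! q = s"
    using ex_nth_sorted_list_of_set[OF fin *(2)] idx(2) by auto
  note U = openin_domain[OF S]
  have det: "det (select_rows (S i) (snd x i)) \<noteq> 0" if "x \<in> ?U" for x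
    using image_rep_in_domain_iff[OF S] that *(1) by blast
  have sel: "regular_mat ?E ?U (e i) (e i) (\<lambda>x. select_rows (S i) (snd x i))"
    using regular_mat_select_rows[OF regular_hom0_coords[OF U *(1)] idx(1)] idx(2) by simp
  have "regular_mat ?E ?U (m i) (e i) (\<lambda>x. snd x i * inverse_mat (select_rows (S i) (snd x i)))"
    by (rule regular_mat_mult[OF U regular_hom0_coords[OF U *(1)] regular_mat_inverse_mat[OF U sel det]])
  from regular_mat_entry[OF this *(3) q(1)] show ?thesis
  proof (rule regular_cong)
    fix x assume x: "x \<in> ?U"
    then have "frame (m i) (S i) (mat_image (snd x i)) = snd x i * inverse_mat (select_rows (S i) (snd x i))"
      using normalize_rows(2)[OF idx(1) _ det[OF x]] points0D(2)[of x i] *(1) idx(2) by simp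
    then have "(snd x i * inverse_mat (select_rows (S i) (snd x i))) $$ (r, q) =
        frame (m i) (S i) (mat_image (snd x i)) $$ (r, q)" by simp
    then show "(snd x i * inverse_mat (select_rows (S i) (snd x i))) $$ (r, q) = (c \<circ> image_rep) x"
      using * q idx(2) by (simp add: frame_def c image_rep_def)
  qed
qed

lemma cover:
  assumes x: "x \<in> points0"
  shows "\<exists>S\<in>chart_indices Q m e. image_rep x \<in> chart_set S"
proof -
  have "\<forall>i\<in>verts Q. \<exists>S. S \<subseteq> {..<m i} \<and> card S = e i \<and> det (select_rows S (snd x i)) \<noteq> 0"
    using ex_nonzero_minor points0D(2,3)[OF x] by metis
  then obtain S where S: "\<forall>i\<in>verts Q. S i \<subseteq> {..<m i} \<and> card (S i) = e i \<and> det (select_rows (S i) (snd x i)) \<noteq> 0"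
    by metis
  then have "restrict S (verts Q) \<in> chart_indices Q m e" by (auto simp: chart_indices_def)
  moreover from this have "image_rep x \<in> chart_set (restrict S (verts Q))"
    using image_rep_in_domain_iff[OF _ x] S by auto
  ultimately show ?thesis by blast
qed

lemma finite_chart_indices: "finite (chart_indices Q m e)"
  unfolding chart_indices_def by (intro finite_PiE) (auto intro: finite_subset[of _ "Pow {..<m _}"])

text \<open>The ambient affine space \<open>B\<close> consists of all pairs of matrix families of
  the right formats, without injectivity or relations. The slice is cut out in it by the
  identity-row equations and the entries of the relations: the former force injectivity, so a
  solution is a framed representation, and \<open>slice_image_rep\<close> places it on the
  slice.\<close>

lemma affine_slice:
  assumes S: "S \<in> chart_indices Q m e"
  shows "\<exists>n F. F \<subseteq> kpoly (affine_coords n) \<and>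
    isomorphic (embedded_space (slice S ` chart_set S) (hom0_coords Q m e)) (affine_variety n F)"
proof -
  define I :: "('a \<times> nat \<times> nat + 'i \<times> nat \<times> nat) set" where
    "I = (SIGMA \<alpha>:arcs Q. {..<e (head Q \<alpha>)} \<times> {..<e (tail Q \<alpha>)}) <+> (SIGMA i:verts Q. {..<m i} \<times> {..<e i})"
  define c :: "_ \<Rightarrow> ('a \<Rightarrow> 'k alg_closure mat) \<times> ('i \<Rightarrow> 'k alg_closure mat) \<Rightarrow> 'k alg_closure" where
    "c = case_sum (\<lambda>(\<alpha>, r, q) (U, f). U \<alpha> $$ (r, q)) (\<lambda>(i, r, q) (U, f). f i $$ (r, q))"
  define B :: "(('a \<Rightarrow> 'k alg_closure mat) \<times> ('i \<Rightarrow> 'k alg_closure mat)) set" where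
    "B = (\<Pi>\<^sub>E \<alpha>\<in>arcs Q. carrier_mat (e (head Q \<alpha>)) (e (tail Q \<alpha>))) \<times> (\<Pi>\<^sub>E i\<in>verts Q. carrier_mat (m i) (e i))"
  let ?C = "hom0_coords Q m e :: (('a \<Rightarrow> 'k alg_closure mat) \<times> ('i \<Rightarrow> 'k alg_closure mat) \<Rightarrow> 'k alg_closure) set"
  let ?D = "slice S ` chart_set S"
  have cI: "c ` I = ?C"
  proof
    show "c ` I \<subseteq> ?C" unfolding I_def c_def hom0_coords_def by fastforce
    show "?C \<subseteq> c ` I"
    proof
      fix t assume "t \<in> ?C"
      then consider \<alpha> r q where "\<alpha> \<in> arcs Q" "r < e (head Q \<alpha>)" "q < e (tail Q \<alpha>)" "t = (\<lambda>(U, f). U \<alpha> $$ (r, q))"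
        | i r q where "i \<in> verts Q" "r < m i" "q < e i" "t = (\<lambda>(U, f). f i $$ (r, q))"
        unfolding hom0_coords_def by blast
      then show "t \<in> c ` I"
      proof cases
        case 1
        then show ?thesis by (intro image_eqI[of _ _ "Inl (\<alpha>, r, q)"]) (auto simp: c_def I_def)
      next
        case 2
        then show ?thesis by (intro image_eqI[of _ _ "Inr (i, r, q)"]) (auto simp: c_def I_def)
      qed
    qed
  qed
  have D_X: "?D \<subseteq> points0" using slice_in[OF S] by blast
  have coordU: "(\<lambda>x. fst x \<alpha> $$ (r, q)) \<in> kpoly ?C"
    if "\<alpha> \<in> arcs Q" "r < e (head Q \<alpha>)" "q < e (tail Q \<alpha>)" for \<alpha> r q
    using that by (intro kpoly.coord) (auto simp: hom0_coords_def case_prod_beta')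
  have coordf: "(\<lambda>x. snd x i $$ (r, q)) \<in> kpoly ?C"
    if "i \<in> verts Q" "r < m i" "q < e i" for i r q
    using that by (intro kpoly.coord) (auto simp: hom0_coords_def case_prod_beta')
  have "\<exists>n F. F \<subseteq> kpoly (affine_coords n) \<and> isomorphic (embedded_space ?D (c ` I)) (affine_variety n F)"
  proof (rule closed_embedded_space_affine[where B = B])
    show "finite I" by (auto simp: I_def)
    show "?D \<subseteq> B" using D_X by (auto simp: B_def hom0_points_def)
  next
    fix x y assume x: "x \<in> B" and y: "y \<in> B" and eq: "\<And>j. j \<in> I \<Longrightarrow> c j x = c j y"
    have "fst x \<alpha> = fst y \<alpha>" if \<alpha>: "\<alpha> \<in> arcs Q" for \<alpha>
    proof (rule eq_matI)
      have xy: "fst x \<alpha> \<in> carrier_mat (e (head Q \<alpha>)) (e (tail Q \<alpha>))" "fst y \<alpha> \<in> carrier_mat (e (head Q \<alpha>)) (e (tail Q \<alpha>))"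
        using x y \<alpha> by (auto simp: B_def)
      then show "dim_row (fst x \<alpha>) = dim_row (fst y \<alpha>)" "dim_col (fst x \<alpha>) = dim_col (fst y \<alpha>)" by auto
      fix r q assume "r < dim_row (fst y \<alpha>)" "q < dim_col (fst y \<alpha>)"
      then show "fst x \<alpha> $$ (r, q) = fst y \<alpha> $$ (r, q)"
        using eq[of "Inl (\<alpha>, r, q)"] xy \<alpha> by (auto simp: c_def I_def case_prod_beta')
    qed
    moreover have "snd x i = snd y i" if i: "i \<in> verts Q" for i
    proof (rule eq_matI)
      have xy: "snd x i \<in> carrier_mat (m i) (e i)" "snd y i \<in> carrier_mat (m i) (e i)"
        using x y i by (auto simp: B_def)
      then show "dim_row (snd x i) = dim_row (snd y i)" "dim_col (snd x i) = dim_col (snd y i)" by auto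
      fix r q assume "r < dim_row (snd y i)" "q < dim_col (snd y i)"
      then show "snd x i $$ (r, q) = snd y i $$ (r, q)"
        using eq[of "Inr (i, r, q)"] xy i by (auto simp: c_def I_def case_prod_beta')
    qed
    ultimately show "x = y"
      using x y unfolding B_def
      by (intro prod_eqI PiE_ext[of "fst x" "arcs Q"] PiE_ext[of "snd x" "verts Q"]) auto
  next
    fix a :: "('a \<times> nat \<times> nat + 'i \<times> nat \<times> nat) \<Rightarrow> 'k alg_closure"
    let ?x = "((\<lambda>\<alpha>\<in>arcs Q. mat (e (head Q \<alpha>)) (e (tail Q \<alpha>)) (\<lambda>(r, q). a (Inl (\<alpha>, r, q)))),
        (\<lambda>i\<in>verts Q. mat (m i) (e i) (\<lambda>(r, q). a (Inr (i, r, q)))))"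
    show "\<exists>x\<in>B. \<forall>j\<in>I. c j x = a j"
      by (rule bexI[of _ ?x]) (auto simp: B_def I_def c_def)
  next
    fix x assume "x \<in> B - ?D"
    then have xB: "x \<in> B" and xD: "x \<notin> ?D" by blast+
    have xU: "fst x \<alpha> \<in> carrier_mat (e (head Q \<alpha>)) (e (tail Q \<alpha>))" if "\<alpha> \<in> arcs Q" for \<alpha>
      using xB that by (auto simp: B_def)
    have xf: "snd x i \<in> carrier_mat (m i) (e i)" if "i \<in> verts Q" for i
      using xB that by (auto simp: B_def)
    \<comment> \<open>Instead of finding by cases which equation fails at \<open>x\<close>, all
      polynomials vanishing on the slice are assumed to vanish at \<open>x\<close>, so that all
      defining equations are available at once.\<close>
    have "\<not> (\<forall>p\<in>kpoly ?C. (\<forall>y\<in>?D. p y = 0) \<longrightarrow> p x = 0)"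
    proof
      assume van: "\<forall>p\<in>kpoly ?C. (\<forall>y\<in>?D. p y = 0) \<longrightarrow> p x = 0"
      have one: "select_rows (S i) (snd x i) = 1\<^sub>m (e i)" if i: "i \<in> verts Q" for i
      proof (rule eq_matI)
        fix r q assume "r < dim_row (1\<^sub>m (e i))" "q < dim_col (1\<^sub>m (e i))"
        then have rq: "r < e i" "q < e i" by simp_all
        let ?r = "sorted_list_of_set (S i) ! r"
        have fin: "finite (S i)" using chart_index(1)[OF S i] finite_subset by blast
        have r: "?r < m i"
          using nth_sorted_list_of_set_in[OF fin, of r] rq(1) chart_index[OF S i] by auto
        let ?p = "\<lambda>x. snd x i $$ (?r, q) - to_ac (if r = q then 1 else 0)"
        have pk: "?p \<in> kpoly ?C" by (intro kpoly_diff kpoly.const coordf i r rq)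
        have pv: "?p y = 0" if y: "y \<in> ?D" for y
        proof -
          obtain N where N: "N \<in> chart_set S" "y = slice S N" using y by blast
          have "select_rows (S i) (frame (m i) (S i) (N i)) $$ (r, q) = 1\<^sub>m (e i) $$ (r, q)"
            using slice_frame(2)[OF S N(1) i] by simp
          then show ?thesis
            using N(2) i rq chart_index(2)[OF S i]
            by (simp add: slice_def complete_def index_select_rows frame_def)
        qed
        have "?p x = 0" by (rule van[rule_format, OF pk]) (rule pv)
        then show "select_rows (S i) (snd x i) $$ (r, q) = 1\<^sub>m (e i) $$ (r, q)"
          using rq xf[OF i] chart_index(2)[OF S i] by (simp add: index_select_rows split: if_splits)
      qed (use xf[OF i] chart_index(2)[OF S i] in simp_all)
      have rel: "AK \<alpha> * snd x (tail Q \<alpha>) = snd x (head Q \<alpha>) * fst x \<alpha>" if \<alpha>: "\<alpha> \<in> arcs Q" for \<alpha>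
      proof (rule eq_matI)
        let ?i = "tail Q \<alpha>" and ?j = "head Q \<alpha>"
        have i: "?i \<in> verts Q" and j: "?j \<in> verts Q" using \<alpha> by auto
        fix r q assume "r < dim_row (snd x ?j * fst x \<alpha>)" "q < dim_col (snd x ?j * fst x \<alpha>)"
        then have rq: "r < m ?j" "q < e ?i" using xU[OF \<alpha>] xf[OF j] by simp_all
        \<comment> \<open>One entry of the relation at \<alpha>, written out as a polynomial whose
          coefficients are entries of the matrix of \<alpha> over k.\<close>
        let ?p = "\<lambda>x. (\<Sum>t<m ?i. to_ac (A \<alpha> $$ (r, t)) * snd x ?i $$ (t, q)) -
            (\<Sum>t<e ?j. snd x ?j $$ (r, t) * fst x \<alpha> $$ (t, q))"
        have p: "?p z = (AK \<alpha> * snd z ?i) $$ (r, q) - (snd z ?j * fst z \<alpha>) $$ (r, q)"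
          if "fst z \<alpha> \<in> carrier_mat (e ?j) (e ?i)" "snd z ?i \<in> carrier_mat (m ?i) (e ?i)"
            "snd z ?j \<in> carrier_mat (m ?j) (e ?j)" for z
          using that rq A_carrier[OF \<alpha>] by (simp add: scalar_prod_def atLeast0LessThan)
        have pk: "?p \<in> kpoly ?C"
          by (intro kpoly_diff kpoly_sum kpoly.mult kpoly.const coordf coordU i j \<alpha>) (use rq in auto)
        have pv: "?p y = 0" if "y \<in> ?D" for y
        proof -
          have y: "y \<in> points0" using D_X that by blast
          show ?thesis
            using p[of y] points0D(1)[OF y \<alpha>] points0D(2)[OF y i] points0D(2)[OF y j]
              points0D(4)[OF y \<alpha>] by simp
        qed
        have "?p x = 0" by (rule van[rule_format, OF pk]) (rule pv)
        then show "(AK \<alpha> * snd x ?i) $$ (r, q) = (snd x ?j * fst x \<alpha>) $$ (r, q)"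
          using p[OF xU[OF \<alpha>] xf[OF i] xf[OF j]] by simp
      next
        have "snd x (tail Q \<alpha>) \<in> carrier_mat (m (tail Q \<alpha>)) (e (tail Q \<alpha>))"
          "snd x (head Q \<alpha>) \<in> carrier_mat (m (head Q \<alpha>)) (e (head Q \<alpha>))"
          using \<alpha> xf by auto
        then show "dim_row (AK \<alpha> * snd x (tail Q \<alpha>)) = dim_row (snd x (head Q \<alpha>) * fst x \<alpha>)"
          "dim_col (AK \<alpha> * snd x (tail Q \<alpha>)) = dim_col (snd x (head Q \<alpha>) * fst x \<alpha>)"
          using A_carrier[OF \<alpha>] xU[OF \<alpha>] by auto
      qed
      have "inj_on (\<lambda>v. snd x i *\<^sub>v v) (carrier_vec (e i))" if i: "i \<in> verts Q" for i
        using normalize_rows(3)[of "S i" "m i" "snd x i"] chart_index[OF S i] xf[OF i] one[OF i] by simp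
      then have "x \<in> points0"
        using xB rel unfolding hom0_points_def B_def by (cases x) auto
      from slice_image_rep[OF S this one] have "x \<in> ?D" by (metis image_eqI)
      then show False using xD by blast
    qed
    then show "\<exists>p\<in>kpoly (c ` I). p x \<noteq> 0 \<and> (\<forall>y\<in>?D. p y = 0)" unfolding cI by blast
  qed
  then show ?thesis unfolding cI .
qed

sublocale atlas: quotient_atlas "GL_group Q e" "GL_act Q e" points0 "hom0_coords Q m e" image_rep
  "chart_indices Q m e" chart_set "chart_coords Q m" slice
  by (rule quotient_atlas.intro)
    (fact act_in(1) orbit_image_rep finite_chart_indices cover slice_in image_rep_slice
      openin_domain slice_coords image_rep_coords affine_slice)+

end

theorem lemma2:
  fixes Q :: "('i, 'a) pre_digraph"
    and scale :: "'k :: field \<Rightarrow> 'v :: ab_group_add \<Rightarrow> 'v"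
    and V :: "'i \<Rightarrow> 'v set" and T :: "'a \<Rightarrow> 'v \<Rightarrow> 'v"
    and m e :: "'i \<Rightarrow> nat"
    and b :: "'i \<Rightarrow> nat \<Rightarrow> 'v"
  assumes "fin_digraph Q" and "acyclic (arcs_ends Q)"
    and "quiver_representation Q scale V T"
    and "has_dimension_vector Q scale V m"
    and "\<forall>i\<in>verts Q. ordered_basis scale (V i) (m i) (b i)"
  shows "let A = representation_matrix Q scale m b T;
             G = GL_group Q e;
             act = GL_act Q e;
             H = hom0 Q A m e;
             quot = orbit_space G act H
         in geometric_quotient G act H quot (Group_Action.orbit G act) \<and>
            isomorphic (quiver_grassmannian Q A m e) quot"
proof -
  interpret fin_digraph Q by (rule assms(1))
  \<comment> \<open>The remaining condition is the format of the representation matrices, which is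
    built into their definition.\<close>
  interpret framed_quiver Q "representation_matrix Q scale m b T" m e
    by unfold_locales (simp add: representation_matrix_def Let_def)
  show ?thesis
    unfolding Let_def hom0_def quiver_grassmannian_def
    using atlas.geometric_quotient_quot atlas.isomorphic_gr_quot by blast
qed

end
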